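(* Let $\Lambda$ be an Artin algebra and let $P$ be an indecomposable non-injective projective $\Lambda$-module. Let $0\to P\xrightarrow{u}B\xrightarrow{v}\tau^{-1}_\Lambda P\to 0$ be an almost split sequence in $\mathrm{mod}\text{-}\Lambda$, let $Q_0\to\tau^{-1}_\Lambda P$ be a projective cover with kernel inclusion $i:\Omega_\Lambda(\tau^{-1}_\Lambda P)\to Q_0$, and consider the pull-back of $v$ along $Q_0\to\tau^{-1}_\Lambda P$, giving the commutative diagram with exact rows and columns $$\begin{array}{ccccc} & & \Omega_\Lambda(\tau^{-1}_\Lambda P) & = & \Omega_\Lambda(\tau^{-1}_\Lambda P)\\ & & \downarrow{\scriptstyle h} & & \downarrow{\scriptstyle i}\\ P & \xrightarrow{[1\ 0]^t} & P\oplus Q_0 & \xrightarrow{[0\ 1]} & Q_0\\ \parallel & & \downarrow{\scriptstyle d} & & \downarrow\\ P & \xrightarrow{u} & B & \xrightarrow{v} & \tau^{-1}_\Lambda P\end{array}$$ Let $j:Q_1\to\Omega_\Lambda(\tau^{-1}_\Lambda P)$ be a projective cover. Then the short exact sequence $$0\to(0\to P)\xrightarrow{(0,\,[1\ 0]^t)}\left(Q_1\xrightarrow{hj}P\oplus Q_0\right)\xrightarrow{(1,\,[0\ 1])}\left(Q_1\xrightarrow{ij}Q_0\right)\to 0$$ is an almost split sequence in $\mathcal{H}(\Lambda)$. In particular, it is an almost split sequence in $\mathcal{P}(\Lambda)$.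
   Context: $\mathrm{mod}\text{-}\Lambda$ is the category of finitely generated $\Lambda$-modules; $\tau_\Lambda$ is the Auslander-Reiten translation and $\Omega_\Lambda$ the syzygy. $\mathcal{H}(\Lambda)$ is the morphism category of $\mathrm{mod}\text{-}\Lambda$: objects are morphisms $f:X\to Y$ in $\mathrm{mod}\text{-}\Lambda$, and a morphism from $(X\xrightarrow{f}Y)$ to $(X'\xrightarrow{f'}Y')$ is a pair $(\sigma_1,\sigma_2)$ with $\sigma_1:X\to X'$, $\sigma_2:Y\to Y'$ and $\sigma_2f=f'\sigma_1$. It is abelian, with exactness computed componentwise. $\mathcal{P}(\Lambda)$ is the full subcategory of $\mathcal{H}(\Lambda)$ of objects $(P\xrightarrow{f}Q)$ with $P,Q$ projective; it is extension-closed and carries the exact structure inherited from $\mathcal{H}(\Lambda)$, with respect to which almost split sequences in $\mathcal{P}(\Lambda)$ are taken. *)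

theory Defs
  imports "HOL-Algebra.Module" "HOL-Algebra.QuotRing"
begin

section \<open>Finitely generated left modules\<close>

text \<open>
  The locale of modules in HOL-Algebra requires a commutative ring of scalars. We keep its record
  type and its notion of submodule, but allow an arbitrary ring. The multiplicative fields of the
  record are irrelevant for modules. Morphisms are functions whose values outside the carrier do
  not matter; accordingly, equality of morphisms is equality on the carrier.
\<close>

locale left_module = R?: ring R + M?: abelian_group M
  for R :: "('a, 'r) ring_scheme" and M :: "('a, 'm, 's) module_scheme" (structure) +
  assumes smult_closed:
      "\<lbrakk>a \<in> carrier R; x \<in> carrier M\<rbrakk> \<Longrightarrow> a \<odot>\<^bsub>M\<^esub> x \<in> carrier M"
    and smult_l_distr:
      "\<lbrakk>a \<in> carrier R; b \<in> carrier R; x \<in> carrier M\<rbrakk> \<Longrightarrow>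
        (a \<oplus>\<^bsub>R\<^esub> b) \<odot>\<^bsub>M\<^esub> x = a \<odot>\<^bsub>M\<^esub> x \<oplus>\<^bsub>M\<^esub> b \<odot>\<^bsub>M\<^esub> x"
    and smult_r_distr:
      "\<lbrakk>a \<in> carrier R; x \<in> carrier M; y \<in> carrier M\<rbrakk> \<Longrightarrow>
        a \<odot>\<^bsub>M\<^esub> (x \<oplus>\<^bsub>M\<^esub> y) = a \<odot>\<^bsub>M\<^esub> x \<oplus>\<^bsub>M\<^esub> a \<odot>\<^bsub>M\<^esub> y"
    and smult_assoc:
      "\<lbrakk>a \<in> carrier R; b \<in> carrier R; x \<in> carrier M\<rbrakk> \<Longrightarrow>
        (a \<otimes>\<^bsub>R\<^esub> b) \<odot>\<^bsub>M\<^esub> x = a \<odot>\<^bsub>M\<^esub> (b \<odot>\<^bsub>M\<^esub> x)"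
    and smult_one:
      "x \<in> carrier M \<Longrightarrow> \<one>\<^bsub>R\<^esub> \<odot>\<^bsub>M\<^esub> x = x"

definition fg_module :: "('a, 'r) ring_scheme \<Rightarrow> ('a, 'm) module \<Rightarrow> bool" where
  "fg_module R M \<longleftrightarrow> left_module R M \<and>
    (\<exists>(n::nat) s. s \<in> {..<n} \<rightarrow> carrier M \<and>
      (\<forall>x \<in> carrier M. \<exists>c \<in> {..<n} \<rightarrow> carrier R.
        x = (\<Oplus>\<^bsub>M\<^esub>i\<in>{..<n}. c i \<odot>\<^bsub>M\<^esub> s i)))"

definition mod_hom ::
  "('a, 'r) ring_scheme \<Rightarrow> ('a, 'm) module \<Rightarrow> ('a, 'n) module \<Rightarrow> ('m \<Rightarrow> 'n) set" where
  "mod_hom R M N = {f \<in> carrier M \<rightarrow> carrier N.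
    (\<forall>x \<in> carrier M. \<forall>y \<in> carrier M. f (x \<oplus>\<^bsub>M\<^esub> y) = f x \<oplus>\<^bsub>N\<^esub> f y) \<and>
    (\<forall>a \<in> carrier R. \<forall>x \<in> carrier M. f (a \<odot>\<^bsub>M\<^esub> x) = a \<odot>\<^bsub>N\<^esub> f x)}"

definition mod_kernel :: "('a, 'm) module \<Rightarrow> ('a, 'n) module \<Rightarrow> ('m \<Rightarrow> 'n) \<Rightarrow> 'm set" where
  "mod_kernel M N f = {x \<in> carrier M. f x = \<zero>\<^bsub>N\<^esub>}"

text \<open>The inclusion of the kernel is the function \<open>\<lambda>x. x\<close>.\<close>

definition kernel_module ::
  "('a, 'm) module \<Rightarrow> ('a, 'n) module \<Rightarrow> ('m \<Rightarrow> 'n) \<Rightarrow> ('a, 'm) module" where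
  "kernel_module M N f = M\<lparr>carrier := mod_kernel M N f\<rparr>"

definition zero_module :: "('a, unit) module" where
  "zero_module = \<lparr>carrier = {()}, mult = (\<lambda>_ _. ()), one = (), zero = (),
    add = (\<lambda>_ _. ()), smult = (\<lambda>_ _. ())\<rparr>"

definition direct_sum :: "('a, 'm) module \<Rightarrow> ('a, 'n) module \<Rightarrow> ('a, 'm \<times> 'n) module" where
  "direct_sum M N = \<lparr>carrier = carrier M \<times> carrier N,
    mult = (\<lambda>x y. (fst x \<otimes>\<^bsub>M\<^esub> fst y, snd x \<otimes>\<^bsub>N\<^esub> snd y)), one = (\<one>\<^bsub>M\<^esub>, \<one>\<^bsub>N\<^esub>),
    zero = (\<zero>\<^bsub>M\<^esub>, \<zero>\<^bsub>N\<^esub>),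
    add = (\<lambda>x y. (fst x \<oplus>\<^bsub>M\<^esub> fst y, snd x \<oplus>\<^bsub>N\<^esub> snd y)),
    smult = (\<lambda>a x. (a \<odot>\<^bsub>M\<^esub> fst x, a \<odot>\<^bsub>N\<^esub> snd x))\<rparr>"

definition short_exact ::
  "('a, 'r) ring_scheme \<Rightarrow> ('a, 'm) module \<Rightarrow> ('m \<Rightarrow> 'n) \<Rightarrow> ('a, 'n) module \<Rightarrow> ('n \<Rightarrow> 'l)
    \<Rightarrow> ('a, 'l) module \<Rightarrow> bool" where
  "short_exact R L f M g N \<longleftrightarrow> f \<in> mod_hom R L M \<and> g \<in> mod_hom R M N \<and>
    inj_on f (carrier L) \<and> f ` carrier L = mod_kernel M N g \<and> g ` carrier M = carrier N"


section \<open>A small category equivalent to mod\<close>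

text \<open>
  A notion defined by a condition on all finitely generated \<open>R\<close>-modules has to quantify over
  modules whose carriers live in one fixed type. The type below is large enough: every finitely
  generated module is isomorphic to one over this type, as proved at the end of this section.
  The modules about which the notions speak may have carriers in any type.
\<close>

type_synonym 'a small = "(nat \<Rightarrow> 'a) set"

lemma transport_module:
  fixes M :: "('a, 'm) module" and e :: "'m \<Rightarrow> 'n"
  assumes M: "fg_module R M" and inj: "inj_on e (carrier M)"
  shows "\<exists>N :: ('a, 'n) module. fg_module R N \<and> e \<in> mod_hom R M N \<and>
           bij_betw e (carrier M) (carrier N)"
proof -
  interpret M: left_module R M using M by (simp add: fg_module_def)
  define d where "d = inv_into (carrier M) e"
  have d[simp]: "d (e x) = x" if "x \<in> carrier M" for x
    using inj that by (simp add: d_def)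
  define N :: "('a, 'n) module" where
    "N = \<lparr>carrier = e ` carrier M, mult = (\<lambda>x y. x), one = e \<zero>\<^bsub>M\<^esub>, zero = e \<zero>\<^bsub>M\<^esub>,
      add = (\<lambda>x y. e (d x \<oplus>\<^bsub>M\<^esub> d y)), smult = (\<lambda>a x. e (a \<odot>\<^bsub>M\<^esub> d x))\<rparr>"
  have N[simp]: "carrier N = e ` carrier M" "\<zero>\<^bsub>N\<^esub> = e \<zero>\<^bsub>M\<^esub>"
    "\<And>x y. x \<oplus>\<^bsub>N\<^esub> y = e (d x \<oplus>\<^bsub>M\<^esub> d y)" "\<And>a x. a \<odot>\<^bsub>N\<^esub> x = e (a \<odot>\<^bsub>M\<^esub> d x)"
    by (simp_all add: N_def)
  have ab: "abelian_group N"
  proof (rule abelian_groupI)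
    fix x assume "x \<in> carrier N"
    then obtain y where y: "y \<in> carrier M" "x = e y" by auto
    then have "e (\<ominus>\<^bsub>M\<^esub> y) \<oplus>\<^bsub>N\<^esub> x = \<zero>\<^bsub>N\<^esub>" by (simp add: M.M.l_neg)
    then show "\<exists>y\<in>carrier N. y \<oplus>\<^bsub>N\<^esub> x = \<zero>\<^bsub>N\<^esub>"
      using y by (intro bexI[of _ "e (\<ominus>\<^bsub>M\<^esub> y)"]) auto
  qed (auto simp: M.M.a_assoc M.M.a_comm M.M.a_lcomm)
  have lm: "left_module R N"
    by (intro left_module.intro left_module_axioms.intro ab M.R.ring_axioms)
      (auto simp: M.smult_closed M.smult_l_distr M.smult_r_distr M.smult_assoc M.smult_one)
  interpret N: left_module R N by (rule lm)
  have hom: "e \<in> mod_hom R M N" by (auto simp: mod_hom_def)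
  have esum: "e (\<Oplus>\<^bsub>M\<^esub>i\<in>{..<n}. f i) = (\<Oplus>\<^bsub>N\<^esub>i\<in>{..<n}. e (f i))"
    if "f \<in> {..<n} \<rightarrow> carrier M" for n :: nat and f
    using that
  proof (induction n)
    case (Suc n)
    then have f: "f \<in> {..<n} \<rightarrow> carrier M" "f n \<in> carrier M" by auto
    then have "(\<Oplus>\<^bsub>M\<^esub>i\<in>{..<n}. f i) \<in> carrier M" by (intro M.M.finsum_closed)
    moreover have "(\<lambda>i. e (f i)) \<in> {..<n} \<rightarrow> carrier N" using f by auto
    ultimately show ?case using f
      by (simp add: lessThan_Suc M.M.finsum_insert N.M.finsum_insert Suc.IH[OF f(1), symmetric])
  qed simp
  obtain n :: nat and s where s: "s \<in> {..<n} \<rightarrow> carrier M"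
    "\<And>x. x \<in> carrier M \<Longrightarrow> \<exists>c \<in> {..<n} \<rightarrow> carrier R. x = (\<Oplus>\<^bsub>M\<^esub>i\<in>{..<n}. c i \<odot>\<^bsub>M\<^esub> s i)"
    using M unfolding fg_module_def by blast
  have "fg_module R N"
    unfolding fg_module_def
  proof (intro conjI lm exI[of _ n] exI[of _ "\<lambda>i. e (s i)"] ballI)
    show "(\<lambda>i. e (s i)) \<in> {..<n} \<rightarrow> carrier N" using s(1) by auto
  next
    fix y assume "y \<in> carrier N"
    then obtain x where x: "x \<in> carrier M" "y = e x" by auto
    obtain c where c: "c \<in> {..<n} \<rightarrow> carrier R" "x = (\<Oplus>\<^bsub>M\<^esub>i\<in>{..<n}. c i \<odot>\<^bsub>M\<^esub> s i)"
      using s(2)[OF x(1)] by blast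
    have "y = (\<Oplus>\<^bsub>N\<^esub>i\<in>{..<n}. e (c i \<odot>\<^bsub>M\<^esub> s i))"
      unfolding x(2) c(2) using c(1) s(1) by (intro esum) (auto intro!: M.smult_closed)
    also have "\<dots> = (\<Oplus>\<^bsub>N\<^esub>i\<in>{..<n}. c i \<odot>\<^bsub>N\<^esub> e (s i))"
    proof (intro N.M.finsum_cong' Pi_I refl)
      fix i assume "i \<in> {..<n}"
      then have "c i \<in> carrier R" "s i \<in> carrier M" using c(1) s(1) by auto
      then show "e (c i \<odot>\<^bsub>M\<^esub> s i) = c i \<odot>\<^bsub>N\<^esub> e (s i)"
        "c i \<odot>\<^bsub>N\<^esub> e (s i) \<in> carrier N"
        by (auto simp: M.smult_closed)
    qed
    finally show "\<exists>c \<in> {..<n} \<rightarrow> carrier R. y = (\<Oplus>\<^bsub>N\<^esub>i\<in>{..<n}. c i \<odot>\<^bsub>N\<^esub> e (s i))"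
      using c(1) by blast
  qed
  moreover have "bij_betw e (carrier M) (carrier N)"
    using inj by (simp add: bij_betw_def)
  ultimately show ?thesis using hom by blast
qed

lemma small_representative:
  fixes R :: "('a, 'r) ring_scheme" and M :: "('a, 'm) module"
  assumes M: "fg_module R M"
  shows "\<exists>(N :: ('a, 'a small) module) e. fg_module R N \<and> e \<in> mod_hom R M N \<and>
           bij_betw e (carrier M) (carrier N)"
proof -
  obtain n :: nat and s where s: "s \<in> {..<n} \<rightarrow> carrier M"
    "\<And>x. x \<in> carrier M \<Longrightarrow> \<exists>c \<in> {..<n} \<rightarrow> carrier R. x = (\<Oplus>\<^bsub>M\<^esub>i\<in>{..<n}. c i \<odot>\<^bsub>M\<^esub> s i)"
    using M unfolding fg_module_def by blast
  define e where "e x = {c \<in> {..<n} \<rightarrow> carrier R. x = (\<Oplus>\<^bsub>M\<^esub>i\<in>{..<n}. c i \<odot>\<^bsub>M\<^esub> s i)}" for x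
  have "inj_on e (carrier M)"
  proof (rule inj_onI)
    fix x y assume *: "x \<in> carrier M" "y \<in> carrier M" "e x = e y"
    obtain c where "c \<in> e x" using s(2)[OF *(1)] by (auto simp: e_def)
    with * show "x = y" by (auto simp: e_def)
  qed
  from transport_module[OF M this] show ?thesis by blast
qed


section \<open>Projective and injective modules, covers and envelopes\<close>

definition projective_module :: "('a, 'r) ring_scheme \<Rightarrow> ('a, 'p) module \<Rightarrow> bool" where
  "projective_module R P \<longleftrightarrow> fg_module R P \<and>
    (\<forall>(X :: ('a, 'a small) module) (Y :: ('a, 'a small) module) g t.
      fg_module R X \<and> fg_module R Y \<and> g \<in> mod_hom R X Y \<and> g ` carrier X = carrier Y \<and>
      t \<in> mod_hom R P Y \<longrightarrow>
      (\<exists>s \<in> mod_hom R P X. \<forall>x \<in> carrier P. g (s x) = t x))"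

definition injective_module :: "('a, 'r) ring_scheme \<Rightarrow> ('a, 'p) module \<Rightarrow> bool" where
  "injective_module R I \<longleftrightarrow> fg_module R I \<and>
    (\<forall>(X :: ('a, 'a small) module) (Y :: ('a, 'a small) module) f t.
      fg_module R X \<and> fg_module R Y \<and> f \<in> mod_hom R X Y \<and> inj_on f (carrier X) \<and>
      t \<in> mod_hom R X I \<longrightarrow>
      (\<exists>s \<in> mod_hom R Y I. \<forall>x \<in> carrier X. s (f x) = t x))"

definition indecomposable_module :: "('a, 'r) ring_scheme \<Rightarrow> ('a, 'm) module \<Rightarrow> bool" where
  "indecomposable_module R M \<longleftrightarrow> left_module R M \<and> carrier M \<noteq> {\<zero>\<^bsub>M\<^esub>} \<and>
    (\<forall>U V. submodule U R M \<and> submodule V R M \<and> U \<inter> V = {\<zero>\<^bsub>M\<^esub>} \<and> U <+>\<^bsub>M\<^esub> V = carrier M \<longrightarrow>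
      U = {\<zero>\<^bsub>M\<^esub>} \<or> V = {\<zero>\<^bsub>M\<^esub>})"

definition projective_cover ::
  "('a, 'r) ring_scheme \<Rightarrow> ('a, 'q) module \<Rightarrow> ('a, 'm) module \<Rightarrow> ('q \<Rightarrow> 'm) \<Rightarrow> bool" where
  "projective_cover R Q M p \<longleftrightarrow> projective_module R Q \<and> fg_module R M \<and>
    p \<in> mod_hom R Q M \<and> p ` carrier Q = carrier M \<and>
    (\<forall>U. submodule U R Q \<and> p ` U = carrier M \<longrightarrow> U = carrier Q)"

definition injective_envelope ::
  "('a, 'r) ring_scheme \<Rightarrow> ('a, 'm) module \<Rightarrow> ('a, 'j) module \<Rightarrow> ('m \<Rightarrow> 'j) \<Rightarrow> bool" where
  "injective_envelope R M J e \<longleftrightarrow> fg_module R M \<and> injective_module R J \<and>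
    e \<in> mod_hom R M J \<and> inj_on e (carrier M) \<and>
    (\<forall>U. submodule U R J \<and> U \<inter> e ` carrier M = {\<zero>\<^bsub>J\<^esub>} \<longrightarrow> U = {\<zero>\<^bsub>J\<^esub>})"


section \<open>Artin algebras and the inverse Auslander--Reiten translation\<close>

text \<open>The additive group of a record, with a new scalar action.\<close>

definition with_smult :: "('b, 'm) ring_scheme \<Rightarrow> ('a \<Rightarrow> 'b \<Rightarrow> 'b) \<Rightarrow> ('a, 'b) module" where
  "with_smult S act = \<lparr>carrier = carrier S, mult = (\<otimes>\<^bsub>S\<^esub>), one = \<one>\<^bsub>S\<^esub>, zero = \<zero>\<^bsub>S\<^esub>,
    add = (\<oplus>\<^bsub>S\<^esub>), smult = act\<rparr>"

definition artinian_ring :: "('a, 'r) ring_scheme \<Rightarrow> bool" where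
  "artinian_ring k \<longleftrightarrow> cring k \<and>
    (\<forall>I :: nat \<Rightarrow> 'a set. (\<forall>n. ideal (I n) k \<and> I (Suc n) \<subseteq> I n) \<longrightarrow>
      (\<exists>n. \<forall>m\<ge>n. I m = I n))"

definition artin_algebra ::
  "('k, 's) ring_scheme \<Rightarrow> ('k \<Rightarrow> 'a) \<Rightarrow> ('a, 'r) ring_scheme \<Rightarrow> bool" where
  "artin_algebra k \<phi> R \<longleftrightarrow> artinian_ring k \<and> ring R \<and> \<phi> \<in> ring_hom k R \<and>
    (\<forall>c \<in> carrier k. \<forall>a \<in> carrier R. \<phi> c \<otimes>\<^bsub>R\<^esub> a = a \<otimes>\<^bsub>R\<^esub> \<phi> c) \<and>
    fg_module k (with_smult R (\<lambda>c a. \<phi> c \<otimes>\<^bsub>R\<^esub> a))"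

definition op_ring :: "('a, 'r) ring_scheme \<Rightarrow> ('a, 'r) ring_scheme" where
  "op_ring R = R\<lparr>mult := (\<lambda>x y. y \<otimes>\<^bsub>R\<^esub> x)\<rparr>"

definition jacobson_radical :: "('a, 'r) ring_scheme \<Rightarrow> 'a set" where
  "jacobson_radical k = carrier k \<inter> \<Inter>{m. maximalideal m k}"

definition semisimple_top :: "('k, 's) ring_scheme \<Rightarrow> ('k, 'k set) module" where
  "semisimple_top k = with_smult (k Quot jacobson_radical k)
    (\<lambda>c X. (jacobson_radical k +>\<^bsub>k\<^esub> c) \<otimes>\<^bsub>k Quot jacobson_radical k\<^esub> X)"

text \<open>
  The group of homomorphisms with an action \<open>act\<close> by another ring. Here homomorphisms are taken to
  be extensional, so that equal morphisms are equal elements.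
\<close>

definition hom_module ::
  "('k, 's) ring_scheme \<Rightarrow> ('k, 'm) module \<Rightarrow> ('k, 'n) module \<Rightarrow> ('a \<Rightarrow> ('m \<Rightarrow> 'n) \<Rightarrow> 'm \<Rightarrow> 'n)
    \<Rightarrow> ('a, 'm \<Rightarrow> 'n) module" where
  "hom_module k M N act = \<lparr>carrier = mod_hom k M N \<inter> extensional (carrier M),
    mult = (\<lambda>f g. f), one = (\<lambda>x\<in>carrier M. \<zero>\<^bsub>N\<^esub>), zero = (\<lambda>x\<in>carrier M. \<zero>\<^bsub>N\<^esub>),
    add = (\<lambda>f g. \<lambda>x\<in>carrier M. f x \<oplus>\<^bsub>N\<^esub> g x),
    smult = (\<lambda>a f. \<lambda>x\<in>carrier M. act a f x)\<rparr>"

text \<open>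
  \<open>D X = Hom\<^sub>k(X, J)\<close>, where \<open>J\<close> is to be an injective envelope of \<open>k/rad k\<close>. Its right action
  \<open>(f a) x = f (a x)\<close> makes it a left module over the opposite ring.
\<close>

definition matlis_dual ::
  "('k, 's) ring_scheme \<Rightarrow> ('k \<Rightarrow> 'a) \<Rightarrow> ('k, 'j) module \<Rightarrow> ('a, 'm) module
    \<Rightarrow> ('a, 'm \<Rightarrow> 'j) module" where
  "matlis_dual k \<phi> J X =
    hom_module k (with_smult X (\<lambda>c x. \<phi> c \<odot>\<^bsub>X\<^esub> x)) J (\<lambda>a f x. f (a \<odot>\<^bsub>X\<^esub> x))"

text \<open>\<open>Hom\<^sub>R(X, R)\<close> with \<open>(f a) x = f x a\<close>, again a left module over the opposite ring.\<close>

definition ring_dual :: "('a, 'r) ring_scheme \<Rightarrow> ('a, 'm) module \<Rightarrow> ('a, 'm \<Rightarrow> 'a) module" where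
  "ring_dual R X = hom_module R X (with_smult R (\<otimes>\<^bsub>R\<^esub>)) (\<lambda>a f x. f x \<otimes>\<^bsub>R\<^esub> a)"

text \<open>
  \<open>T \<cong> Tr M\<close>: for a minimal projective presentation \<open>P\<^sub>1 \<rightarrow> P\<^sub>0 \<rightarrow> M \<rightarrow> 0\<close>, the module \<open>T\<close> over the
  opposite ring is a cokernel of \<open>Hom\<^sub>R(P\<^sub>0, R) \<rightarrow> Hom\<^sub>R(P\<^sub>1, R)\<close>.
\<close>

definition is_transpose ::
  "('a, 'r) ring_scheme \<Rightarrow> ('a, 'm) module \<Rightarrow> ('a, 't) module \<Rightarrow> bool" where
  "is_transpose R M T \<longleftrightarrow> left_module (op_ring R) T \<and>
    (\<exists>(P1 :: ('a, 'a small) module) (P0 :: ('a, 'a small) module) f p q.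
      projective_cover R P0 M p \<and> projective_cover R P1 (kernel_module P0 M p) f \<and>
      q \<in> mod_hom (op_ring R) (ring_dual R P1) T \<and>
      q ` carrier (ring_dual R P1) = carrier T \<and>
      mod_kernel (ring_dual R P1) T q =
        (\<lambda>g. restrict (g \<circ> f) (carrier P1)) ` carrier (ring_dual R P0))"

text \<open>\<open>Y \<cong> \<tau>\<^sup>-\<^sup>1 X = Tr (D X)\<close>.\<close>

definition is_inverse_AR_translate ::
  "('k, 's) ring_scheme \<Rightarrow> ('k \<Rightarrow> 'a) \<Rightarrow> ('a, 'r) ring_scheme
    \<Rightarrow> ('a, 'x) module \<Rightarrow> ('a, 'y) module \<Rightarrow> bool" where
  "is_inverse_AR_translate k \<phi> R X Y \<longleftrightarrow>
    (\<exists>(J :: ('k, 'k small) module) e. injective_envelope k (semisimple_top k) J e \<and>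
      is_transpose (op_ring R) (matlis_dual k \<phi> J X) Y) \<and> left_module R Y"


section \<open>Almost split sequences of modules, pull-backs\<close>

definition split_mono ::
  "('a, 'r) ring_scheme \<Rightarrow> ('a, 'm) module \<Rightarrow> ('a, 'n) module \<Rightarrow> ('m \<Rightarrow> 'n) \<Rightarrow> bool" where
  "split_mono R M N f \<longleftrightarrow> (\<exists>r \<in> mod_hom R N M. \<forall>x \<in> carrier M. r (f x) = x)"

definition split_epi ::
  "('a, 'r) ring_scheme \<Rightarrow> ('a, 'm) module \<Rightarrow> ('a, 'n) module \<Rightarrow> ('m \<Rightarrow> 'n) \<Rightarrow> bool" where
  "split_epi R M N g \<longleftrightarrow> (\<exists>s \<in> mod_hom R N M. \<forall>y \<in> carrier N. g (s y) = y)"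

definition left_almost_split ::
  "('a, 'r) ring_scheme \<Rightarrow> ('a, 'm) module \<Rightarrow> ('a, 'n) module \<Rightarrow> ('m \<Rightarrow> 'n) \<Rightarrow> bool" where
  "left_almost_split R M N f \<longleftrightarrow> f \<in> mod_hom R M N \<and> \<not> split_mono R M N f \<and>
    (\<forall>(X :: ('a, 'a small) module) t.
      fg_module R X \<and> t \<in> mod_hom R M X \<and> \<not> split_mono R M X t \<longrightarrow>
      (\<exists>s \<in> mod_hom R N X. \<forall>x \<in> carrier M. s (f x) = t x))"

definition right_almost_split ::
  "('a, 'r) ring_scheme \<Rightarrow> ('a, 'm) module \<Rightarrow> ('a, 'n) module \<Rightarrow> ('m \<Rightarrow> 'n) \<Rightarrow> bool" where
  "right_almost_split R M N g \<longleftrightarrow> g \<in> mod_hom R M N \<and> \<not> split_epi R M N g \<and>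
    (\<forall>(X :: ('a, 'a small) module) t.
      fg_module R X \<and> t \<in> mod_hom R X N \<and> \<not> split_epi R X N t \<longrightarrow>
      (\<exists>s \<in> mod_hom R X M. \<forall>x \<in> carrier X. g (s x) = t x))"

definition almost_split ::
  "('a, 'r) ring_scheme \<Rightarrow> ('a, 'l) module \<Rightarrow> ('l \<Rightarrow> 'm) \<Rightarrow> ('a, 'm) module \<Rightarrow> ('m \<Rightarrow> 'n)
    \<Rightarrow> ('a, 'n) module \<Rightarrow> bool" where
  "almost_split R L f M g N \<longleftrightarrow> fg_module R L \<and> fg_module R M \<and> fg_module R N \<and>
    short_exact R L f M g N \<and> left_almost_split R L M f \<and> right_almost_split R M N g"

text \<open>\<open>W\<close> with \<open>a : W \<rightarrow> X\<close> and \<open>b : W \<rightarrow> Y\<close> is a pull-back of \<open>f : X \<rightarrow> Z\<close> along \<open>g : Y \<rightarrow> Z\<close>.\<close>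

definition is_pullback ::
  "('a, 'r) ring_scheme \<Rightarrow> ('a, 'x) module \<Rightarrow> ('x \<Rightarrow> 'z) \<Rightarrow> ('a, 'y) module \<Rightarrow> ('y \<Rightarrow> 'z)
    \<Rightarrow> ('a, 'w) module \<Rightarrow> ('w \<Rightarrow> 'x) \<Rightarrow> ('w \<Rightarrow> 'y) \<Rightarrow> bool" where
  "is_pullback R X f Y g W a b \<longleftrightarrow>
    a \<in> mod_hom R W X \<and> b \<in> mod_hom R W Y \<and> (\<forall>w \<in> carrier W. f (a w) = g (b w)) \<and>
    (\<forall>(T :: ('a, 'a small) module) s t.
      fg_module R T \<and> s \<in> mod_hom R T X \<and> t \<in> mod_hom R T Y \<and>
      (\<forall>x \<in> carrier T. f (s x) = g (t x)) \<longrightarrow>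
      (\<exists>m \<in> mod_hom R T W. \<forall>x \<in> carrier T. a (m x) = s x \<and> b (m x) = t x) \<and>
      (\<forall>m \<in> mod_hom R T W. \<forall>m' \<in> mod_hom R T W.
        (\<forall>x \<in> carrier T. a (m x) = s x \<and> b (m x) = t x) \<and>
        (\<forall>x \<in> carrier T. a (m' x) = s x \<and> b (m' x) = t x) \<longrightarrow>
        (\<forall>x \<in> carrier T. m x = m' x)))"


section \<open>The morphism category\<close>

datatype ('a, 'x, 'y) morph_obj =
  Mor (src: "('a, 'x) module") (arr: "'x \<Rightarrow> 'y") (tgt: "('a, 'y) module")

definition H_obj :: "('a, 'r) ring_scheme \<Rightarrow> ('a, 'x, 'y) morph_obj \<Rightarrow> bool" where
  "H_obj R X \<longleftrightarrow> fg_module R (src X) \<and> fg_module R (tgt X) \<and> arr X \<in> mod_hom R (src X) (tgt X)"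

definition P_obj :: "('a, 'r) ring_scheme \<Rightarrow> ('a, 'x, 'y) morph_obj \<Rightarrow> bool" where
  "P_obj R X \<longleftrightarrow> H_obj R X \<and> projective_module R (src X) \<and> projective_module R (tgt X)"

definition H_hom ::
  "('a, 'r) ring_scheme \<Rightarrow> ('a, 'x, 'y) morph_obj \<Rightarrow> ('a, 'u, 'v) morph_obj
    \<Rightarrow> (('x \<Rightarrow> 'u) \<times> ('y \<Rightarrow> 'v)) set" where
  "H_hom R X Y = {(\<sigma>1, \<sigma>2). \<sigma>1 \<in> mod_hom R (src X) (src Y) \<and> \<sigma>2 \<in> mod_hom R (tgt X) (tgt Y) \<and>
    (\<forall>x \<in> carrier (src X). \<sigma>2 (arr X x) = arr Y (\<sigma>1 x))}"

text \<open>\<open>g \<circ> f = t\<close> as morphisms with domain \<open>X\<close>.\<close>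

definition H_comp_eq ::
  "('a, 'x, 'y) morph_obj \<Rightarrow> ('u \<Rightarrow> 's) \<times> ('v \<Rightarrow> 't) \<Rightarrow> ('x \<Rightarrow> 'u) \<times> ('y \<Rightarrow> 'v)
    \<Rightarrow> ('x \<Rightarrow> 's) \<times> ('y \<Rightarrow> 't) \<Rightarrow> bool" where
  "H_comp_eq X g f t \<longleftrightarrow> (\<forall>x \<in> carrier (src X). fst g (fst f x) = fst t x) \<and>
    (\<forall>y \<in> carrier (tgt X). snd g (snd f y) = snd t y)"

definition H_id :: "('x \<Rightarrow> 'x) \<times> ('y \<Rightarrow> 'y)" where
  "H_id = (\<lambda>x. x, \<lambda>y. y)"

definition H_split_mono ::
  "('a, 'r) ring_scheme \<Rightarrow> ('a, 'x, 'y) morph_obj \<Rightarrow> ('a, 'u, 'v) morph_obj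
    \<Rightarrow> ('x \<Rightarrow> 'u) \<times> ('y \<Rightarrow> 'v) \<Rightarrow> bool" where
  "H_split_mono R X Y f \<longleftrightarrow> (\<exists>r \<in> H_hom R Y X. H_comp_eq X r f H_id)"

definition H_split_epi ::
  "('a, 'r) ring_scheme \<Rightarrow> ('a, 'x, 'y) morph_obj \<Rightarrow> ('a, 'u, 'v) morph_obj
    \<Rightarrow> ('x \<Rightarrow> 'u) \<times> ('y \<Rightarrow> 'v) \<Rightarrow> bool" where
  "H_split_epi R X Y g \<longleftrightarrow> (\<exists>s \<in> H_hom R Y X. H_comp_eq Y g s H_id)"

text \<open>
  The notions below are relative to the full subcategory of the morphism category with object
  class \<open>Ob\<close>, which is given by its objects over the small carrier type.
\<close>

definition H_left_almost_split ::
  "('a, 'r) ring_scheme \<Rightarrow> (('a, 'a small, 'a small) morph_obj \<Rightarrow> bool)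
    \<Rightarrow> ('a, 'x, 'y) morph_obj \<Rightarrow> ('a, 'u, 'v) morph_obj \<Rightarrow> ('x \<Rightarrow> 'u) \<times> ('y \<Rightarrow> 'v) \<Rightarrow> bool" where
  "H_left_almost_split R Ob A B f \<longleftrightarrow> f \<in> H_hom R A B \<and> \<not> H_split_mono R A B f \<and>
    (\<forall>X t. Ob X \<and> t \<in> H_hom R A X \<and> \<not> H_split_mono R A X t \<longrightarrow>
      (\<exists>s \<in> H_hom R B X. H_comp_eq A s f t))"

definition H_right_almost_split ::
  "('a, 'r) ring_scheme \<Rightarrow> (('a, 'a small, 'a small) morph_obj \<Rightarrow> bool)
    \<Rightarrow> ('a, 'x, 'y) morph_obj \<Rightarrow> ('a, 'u, 'v) morph_obj \<Rightarrow> ('x \<Rightarrow> 'u) \<times> ('y \<Rightarrow> 'v) \<Rightarrow> bool" where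
  "H_right_almost_split R Ob B C g \<longleftrightarrow> g \<in> H_hom R B C \<and> \<not> H_split_epi R B C g \<and>
    (\<forall>X t. Ob X \<and> t \<in> H_hom R X C \<and> \<not> H_split_epi R X C t \<longrightarrow>
      (\<exists>s \<in> H_hom R X B. H_comp_eq X g s t))"

definition H_short_exact ::
  "('a, 'r) ring_scheme \<Rightarrow> ('a, 'x, 'y) morph_obj \<Rightarrow> ('x \<Rightarrow> 'u) \<times> ('y \<Rightarrow> 'v)
    \<Rightarrow> ('a, 'u, 'v) morph_obj \<Rightarrow> ('u \<Rightarrow> 's) \<times> ('v \<Rightarrow> 't) \<Rightarrow> ('a, 's, 't) morph_obj \<Rightarrow> bool" where
  "H_short_exact R A f B g C \<longleftrightarrow> f \<in> H_hom R A B \<and> g \<in> H_hom R B C \<and>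
    short_exact R (src A) (fst f) (src B) (fst g) (src C) \<and>
    short_exact R (tgt A) (snd f) (tgt B) (snd g) (tgt C)"

definition almost_split_in_H ::
  "('a, 'r) ring_scheme \<Rightarrow> ('a, 'x, 'y) morph_obj \<Rightarrow> ('x \<Rightarrow> 'u) \<times> ('y \<Rightarrow> 'v)
    \<Rightarrow> ('a, 'u, 'v) morph_obj \<Rightarrow> ('u \<Rightarrow> 's) \<times> ('v \<Rightarrow> 't) \<Rightarrow> ('a, 's, 't) morph_obj \<Rightarrow> bool" where
  "almost_split_in_H R A f B g C \<longleftrightarrow> H_obj R A \<and> H_obj R B \<and> H_obj R C \<and>
    H_short_exact R A f B g C \<and>
    H_left_almost_split R (H_obj R) A B f \<and> H_right_almost_split R (H_obj R) B C g"

definition almost_split_in_P ::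
  "('a, 'r) ring_scheme \<Rightarrow> ('a, 'x, 'y) morph_obj \<Rightarrow> ('x \<Rightarrow> 'u) \<times> ('y \<Rightarrow> 'v)
    \<Rightarrow> ('a, 'u, 'v) morph_obj \<Rightarrow> ('u \<Rightarrow> 's) \<times> ('v \<Rightarrow> 't) \<Rightarrow> ('a, 's, 't) morph_obj \<Rightarrow> bool" where
  "almost_split_in_P R A f B g C \<longleftrightarrow> P_obj R A \<and> P_obj R B \<and> P_obj R C \<and>
    H_short_exact R A f B g C \<and>
    H_left_almost_split R (P_obj R) A B f \<and> H_right_almost_split R (P_obj R) B C g"

end

theory Submission
  imports Defs
begin

text \<open>
  Passing to cokernels sends the sequence in the morphism category to \<open>P \<rightarrow> B \<rightarrow> C\<close>, with
  \<open>C = \<tau>\<^sup>-\<^sup>1 P\<close>: the cokernel of \<open>h j\<close> is \<open>d\<close>, and that of \<open>i j\<close> is the projective cover \<open>q\<close> of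
  \<open>C\<close>. A splitting of the sequence would therefore split \<open>P \<rightarrow> B \<rightarrow> C\<close>.

  Given a morphism from \<open>0 \<rightarrow> P\<close> to \<open>X\<^sub>1 \<rightarrow> X\<^sub>2\<close> that is no split monomorphism, the induced map from
  \<open>P\<close> to the cokernel \<open>K\<close> of \<open>X\<^sub>1 \<rightarrow> X\<^sub>2\<close> is none either, so it extends to \<open>B\<close>; the extension lifts
  to the presentations because \<open>Q\<^sub>0\<close> and \<open>Q\<^sub>1\<close> are projective.

  Given a morphism from \<open>X\<^sub>1 \<rightarrow> X\<^sub>2\<close> to \<open>Q\<^sub>1 \<rightarrow> Q\<^sub>0\<close> that is no split epimorphism, the induced map from
  \<open>K\<close> to \<open>C\<close> is none either: a section of it lifts to \<open>Q\<^sub>0 \<rightarrow> X\<^sub>2\<close> and \<open>Q\<^sub>1 \<rightarrow> X\<^sub>1\<close>, and minimality of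
  the covers makes these into sections. So the induced map factors through \<open>B\<close>, and the pull-back
  property turns the factorization into a morphism to \<open>Q\<^sub>1 \<rightarrow> P \<oplus> Q\<^sub>0\<close>.
\<close>

section \<open>Homomorphisms\<close>

lemma (in abelian_group) minus_self: "x \<in> carrier G \<Longrightarrow> x \<ominus> x = \<zero>"
  by (simp add: minus_eq r_neg)

lemma (in abelian_group) minus_add_cancel:
  "x \<in> carrier G \<Longrightarrow> y \<in> carrier G \<Longrightarrow> (x \<ominus> y) \<oplus> y = x"
  by (simp add: minus_eq a_assoc l_neg)

lemma (in abelian_group) minus_zero_right: "x \<in> carrier G \<Longrightarrow> x \<ominus> \<zero> = x"
  using minus_add_cancel[of x \<zero>] by simp

lemma (in abelian_group) minus_eq_zero_iff:
  assumes "x \<in> carrier G" "y \<in> carrier G"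
  shows "x \<ominus> y = \<zero> \<longleftrightarrow> x = y"
  using minus_add_cancel[OF assms] minus_self assms by force

lemma (in abelian_group) minus_trans:
  "x \<in> carrier G \<Longrightarrow> y \<in> carrier G \<Longrightarrow> z \<in> carrier G \<Longrightarrow> (x \<ominus> y) \<oplus> (y \<ominus> z) = x \<ominus> z"
  by (simp add: minus_eq a_assoc r_neg1)

lemma (in abelian_group) neg_minus:
  "x \<in> carrier G \<Longrightarrow> y \<in> carrier G \<Longrightarrow> \<ominus> (x \<ominus> y) = y \<ominus> x"
  by (simp add: minus_eq minus_add a_comm)

lemma (in abelian_group) add_minus_add:
  "\<lbrakk>x \<in> carrier G; y \<in> carrier G; x' \<in> carrier G; y' \<in> carrier G\<rbrakk> \<Longrightarrow>
    (x \<oplus> y) \<ominus> (x' \<oplus> y') = (x \<ominus> x') \<oplus> (y \<ominus> y')"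
  by (simp add: minus_eq minus_add a_ac)

lemma (in left_module) smult_zero:
  assumes "a \<in> carrier R"
  shows "a \<odot>\<^bsub>M\<^esub> \<zero>\<^bsub>M\<^esub> = \<zero>\<^bsub>M\<^esub>"
  using smult_r_distr[OF assms, of "\<zero>\<^bsub>M\<^esub>" "\<zero>\<^bsub>M\<^esub>"] smult_closed[OF assms, of "\<zero>\<^bsub>M\<^esub>"]
  by (simp add: M.add.r_cancel_one)

lemma fg_imp_left_module: "fg_module R M \<Longrightarrow> left_module R M"
  by (simp add: fg_module_def)

lemma mod_homI:
  assumes "\<And>x. x \<in> carrier M \<Longrightarrow> f x \<in> carrier N"
    and "\<And>x y. x \<in> carrier M \<Longrightarrow> y \<in> carrier M \<Longrightarrow> f (x \<oplus>\<^bsub>M\<^esub> y) = f x \<oplus>\<^bsub>N\<^esub> f y"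
    and "\<And>a x. a \<in> carrier R \<Longrightarrow> x \<in> carrier M \<Longrightarrow> f (a \<odot>\<^bsub>M\<^esub> x) = a \<odot>\<^bsub>N\<^esub> f x"
  shows "f \<in> mod_hom R M N"
  using assms by (auto simp: mod_hom_def)

lemma mod_hom_closed: "f \<in> mod_hom R M N \<Longrightarrow> x \<in> carrier M \<Longrightarrow> f x \<in> carrier N"
  by (auto simp: mod_hom_def)

lemma mod_hom_add:
  "f \<in> mod_hom R M N \<Longrightarrow> x \<in> carrier M \<Longrightarrow> y \<in> carrier M \<Longrightarrow> f (x \<oplus>\<^bsub>M\<^esub> y) = f x \<oplus>\<^bsub>N\<^esub> f y"
  by (auto simp: mod_hom_def)

lemma mod_hom_smult:
  "f \<in> mod_hom R M N \<Longrightarrow> a \<in> carrier R \<Longrightarrow> x \<in> carrier M \<Longrightarrow> f (a \<odot>\<^bsub>M\<^esub> x) = a \<odot>\<^bsub>N\<^esub> f x"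
  by (auto simp: mod_hom_def)

lemma mod_hom_comp:
  "f \<in> mod_hom R L M \<Longrightarrow> g \<in> mod_hom R M N \<Longrightarrow> (\<lambda>x. g (f x)) \<in> mod_hom R L N"
  by (auto simp: mod_hom_def Pi_iff)

lemma mod_hom_id: "(\<lambda>x. x) \<in> mod_hom R M M"
  by (auto simp: mod_hom_def)

lemma mod_hom_zero:
  assumes "left_module R M" "left_module R N" and f: "f \<in> mod_hom R M N"
  shows "f \<zero>\<^bsub>M\<^esub> = \<zero>\<^bsub>N\<^esub>"
proof -
  interpret M: left_module R M by fact
  interpret N: left_module R N by fact
  have "f \<zero>\<^bsub>M\<^esub> \<oplus>\<^bsub>N\<^esub> f \<zero>\<^bsub>M\<^esub> = f \<zero>\<^bsub>M\<^esub>"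
    using mod_hom_add[OF f, of "\<zero>\<^bsub>M\<^esub>" "\<zero>\<^bsub>M\<^esub>"] by simp
  then show ?thesis
    using mod_hom_closed[OF f, of "\<zero>\<^bsub>M\<^esub>"] by (simp add: N.M.add.r_cancel_one')
qed

lemma mod_hom_neg:
  assumes "left_module R M" "left_module R N" and f: "f \<in> mod_hom R M N"
    and x: "x \<in> carrier M"
  shows "f (\<ominus>\<^bsub>M\<^esub> x) = \<ominus>\<^bsub>N\<^esub> f x"
proof -
  interpret M: left_module R M by fact
  interpret N: left_module R N by fact
  have "f (\<ominus>\<^bsub>M\<^esub> x) \<oplus>\<^bsub>N\<^esub> f x = \<zero>\<^bsub>N\<^esub>"
    using mod_hom_add[OF f, of "\<ominus>\<^bsub>M\<^esub> x" x] x mod_hom_zero[OF assms(1,2) f]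
    by (simp add: M.M.l_neg)
  then show ?thesis
    using mod_hom_closed[OF f] x by (metis M.M.a_inv_closed N.M.minus_equality)
qed

text \<open>Turns equality of two values into vanishing at a difference, the form in which
  conditions on a kernel apply.\<close>

lemma mod_hom_eq_iff:
  assumes "left_module R M" "left_module R N" and f: "f \<in> mod_hom R M N"
    and x: "x \<in> carrier M" and y: "y \<in> carrier M"
  shows "f x = f y \<longleftrightarrow> f (x \<ominus>\<^bsub>M\<^esub> y) = \<zero>\<^bsub>N\<^esub>"
proof -
  interpret M: left_module R M by fact
  interpret N: left_module R N by fact
  have "f (x \<ominus>\<^bsub>M\<^esub> y) = f x \<ominus>\<^bsub>N\<^esub> f y"
    using x y mod_hom_add[OF f] mod_hom_neg[OF assms(1,2) f]
    by (simp add: a_minus_def)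
  then show ?thesis
    using x y mod_hom_closed[OF f] by (simp add: N.M.minus_eq_zero_iff)
qed

lemma mod_hom_add_fun:
  assumes "left_module R N" and f: "f \<in> mod_hom R M N" and g: "g \<in> mod_hom R M N"
  shows "(\<lambda>x. f x \<oplus>\<^bsub>N\<^esub> g x) \<in> mod_hom R M N"
proof -
  interpret N: left_module R N by fact
  note [simp] = mod_hom_closed[OF f] mod_hom_closed[OF g]
  show ?thesis
    by (rule mod_homI)
      (simp_all add: mod_hom_add[OF f] mod_hom_add[OF g] mod_hom_smult[OF f] mod_hom_smult[OF g]
        N.smult_r_distr N.M.add.m_ac)
qed

lemma mod_hom_finsum:
  fixes n :: nat
  assumes "left_module R M" "left_module R N" and f: "f \<in> mod_hom R M N"
    and s: "s \<in> {..<n} \<rightarrow> carrier M"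
  shows "f (\<Oplus>\<^bsub>M\<^esub>i\<in>{..<n}. s i) = (\<Oplus>\<^bsub>N\<^esub>i\<in>{..<n}. f (s i))"
  using s
proof (induction n)
  interpret M: left_module R M by fact
  interpret N: left_module R N by fact
  case 0
  then show ?case by (simp add: mod_hom_zero[OF assms(1,2) f])
next
  interpret M: left_module R M by fact
  interpret N: left_module R N by fact
  case (Suc n)
  then have s: "s \<in> {..<n} \<rightarrow> carrier M" "s n \<in> carrier M" by auto
  then have "(\<lambda>i. f (s i)) \<in> {..<n} \<rightarrow> carrier N" "f (s n) \<in> carrier N"
    using mod_hom_closed[OF f] by auto
  moreover have "(\<Oplus>\<^bsub>M\<^esub>i\<in>{..<n}. s i) \<in> carrier M" using s by (intro M.M.finsum_closed)
  ultimately show ?case using s Suc.IH[OF s(1)]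
    by (simp add: lessThan_Suc M.M.finsum_insert N.M.finsum_insert mod_hom_add[OF f])
qed

text \<open>The factor sends \<open>y\<close> to the value of \<open>g\<close> at a chosen preimage.
  Two preimages differ by an element killed by \<open>p\<close>, hence by \<open>g\<close>, so the
  choice does not matter and linearity carries over.\<close>

lemma mod_hom_factor:
  assumes "left_module R M" "left_module R N" "left_module R L"
    and p: "p \<in> mod_hom R M N" "p ` carrier M = carrier N" and g: "g \<in> mod_hom R M L"
    and ker: "\<And>x. x \<in> carrier M \<Longrightarrow> p x = \<zero>\<^bsub>N\<^esub> \<Longrightarrow> g x = \<zero>\<^bsub>L\<^esub>"
  shows "\<exists>g' \<in> mod_hom R N L. \<forall>x \<in> carrier M. g' (p x) = g x"
proof -
  interpret M: left_module R M by fact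
  define r where "r = inv_into (carrier M) p"
  have r: "r y \<in> carrier M" "p (r y) = y" if "y \<in> carrier N" for y
    using that inv_into_into[of y p "carrier M"] f_inv_into_f[of y p "carrier M"]
    unfolding r_def p(2) by blast+
  have eq: "g x = g y" if xy: "x \<in> carrier M" "y \<in> carrier M" and "p x = p y" for x y
  proof -
    have "p (x \<ominus>\<^bsub>M\<^esub> y) = \<zero>\<^bsub>N\<^esub>"
      using mod_hom_eq_iff[OF assms(1,2) p(1) xy] that(3) by blast
    then show ?thesis
      using mod_hom_eq_iff[OF assms(1,3) g xy] ker[of "x \<ominus>\<^bsub>M\<^esub> y"] xy by simp
  qed
  have fac: "g (r (p x)) = g x" if "x \<in> carrier M" for x
    using that r mod_hom_closed[OF p(1)] by (intro eq) auto
  have "(\<lambda>y. g (r y)) \<in> mod_hom R N L"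
  proof (rule mod_homI)
    fix y assume "y \<in> carrier N"
    then show "g (r y) \<in> carrier L" by (intro mod_hom_closed[OF g] r)
  next
    fix y z assume yz: "y \<in> carrier N" "z \<in> carrier N"
    have "g (r (y \<oplus>\<^bsub>N\<^esub> z)) = g (r (p (r y \<oplus>\<^bsub>M\<^esub> r z)))"
      using yz r by (simp add: mod_hom_add[OF p(1)])
    also have "\<dots> = g (r y) \<oplus>\<^bsub>L\<^esub> g (r z)"
      using yz r by (simp add: fac mod_hom_add[OF g])
    finally show "g (r (y \<oplus>\<^bsub>N\<^esub> z)) = g (r y) \<oplus>\<^bsub>L\<^esub> g (r z)" .
  next
    fix a y assume ay: "a \<in> carrier R" "y \<in> carrier N"
    have "g (r (a \<odot>\<^bsub>N\<^esub> y)) = g (r (p (a \<odot>\<^bsub>M\<^esub> r y)))"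
      using ay r by (simp add: mod_hom_smult[OF p(1)])
    also have "\<dots> = a \<odot>\<^bsub>L\<^esub> g (r y)"
      using ay r by (simp add: fac mod_hom_smult[OF g] M.smult_closed)
    finally show "g (r (a \<odot>\<^bsub>N\<^esub> y)) = a \<odot>\<^bsub>L\<^esub> g (r y)" .
  qed
  then show ?thesis using fac by (intro bexI[of _ "\<lambda>y. g (r y)"]) simp_all
qed

text \<open>A bijective homomorphism has trivial kernel, so the identity factors through it; the
  factor is the inverse.\<close>

lemma mod_hom_inverse:
  assumes "left_module R M" "left_module R N" "e \<in> mod_hom R M N"
    and bij: "bij_betw e (carrier M) (carrier N)"
  shows "\<exists>d \<in> mod_hom R N M. \<forall>x \<in> carrier M. d (e x) = x"
proof (rule mod_hom_factor[OF assms(1,2,1) assms(3) _ mod_hom_id])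
  show "e ` carrier M = carrier N" using bij by (simp add: bij_betw_def)
next
  interpret M: left_module R M by fact
  fix x assume x: "x \<in> carrier M" "e x = \<zero>\<^bsub>N\<^esub>"
  then have "e x = e \<zero>\<^bsub>M\<^esub>" using mod_hom_zero[OF assms(1-3)] by simp
  then show "x = \<zero>\<^bsub>M\<^esub>"
    using x(1) by (rule inj_onD[OF bij_betw_imp_inj_on[OF bij]]) simp
qed

section \<open>Images and cokernels\<close>

text \<open>Closure under negatives is a separate assumption instead of being derived from the
  scalar -1, because for images it comes directly from \<open>mod_hom_neg\<close>.\<close>

lemma left_module_subset:
  assumes "left_module R M" and sub: "U \<subseteq> carrier M" and zero: "\<zero>\<^bsub>M\<^esub> \<in> U"
    and add: "\<And>x y. x \<in> U \<Longrightarrow> y \<in> U \<Longrightarrow> x \<oplus>\<^bsub>M\<^esub> y \<in> U"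
    and smult: "\<And>a x. a \<in> carrier R \<Longrightarrow> x \<in> U \<Longrightarrow> a \<odot>\<^bsub>M\<^esub> x \<in> U"
    and neg: "\<And>x. x \<in> U \<Longrightarrow> \<ominus>\<^bsub>M\<^esub> x \<in> U"
  shows "left_module R (M\<lparr>carrier := U\<rparr>)"
proof -
  interpret M: left_module R M by fact
  have U: "x \<in> carrier M" if "x \<in> U" for x using that sub by blast
  have "abelian_group (M\<lparr>carrier := U\<rparr>)"
  proof (rule abelian_groupI)
    fix x assume "x \<in> carrier (M\<lparr>carrier := U\<rparr>)"
    then have x: "x \<in> U" by simp
    then show "\<exists>y \<in> carrier (M\<lparr>carrier := U\<rparr>). y \<oplus>\<^bsub>M\<lparr>carrier := U\<rparr>\<^esub> x = \<zero>\<^bsub>M\<lparr>carrier := U\<rparr>\<^esub>"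
      using neg[OF x] M.M.l_neg[OF U[OF x]] by (intro bexI[of _ "\<ominus>\<^bsub>M\<^esub> x"]) simp_all
  qed (use U zero add M.M.a_assoc M.M.a_comm in simp_all)
  then show ?thesis
    by (intro left_module.intro left_module_axioms.intro M.R.ring_axioms)
      (use U smult M.smult_l_distr M.smult_r_distr M.smult_assoc M.smult_one in simp_all)
qed

lemma image_closed:
  assumes "left_module R M" "left_module R N" and f: "f \<in> mod_hom R M N"
  shows "f ` carrier M \<subseteq> carrier N" "\<zero>\<^bsub>N\<^esub> \<in> f ` carrier M"
    and "\<And>x y. x \<in> f ` carrier M \<Longrightarrow> y \<in> f ` carrier M \<Longrightarrow> x \<oplus>\<^bsub>N\<^esub> y \<in> f ` carrier M"
    and "\<And>a x. a \<in> carrier R \<Longrightarrow> x \<in> f ` carrier M \<Longrightarrow> a \<odot>\<^bsub>N\<^esub> x \<in> f ` carrier M"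
    and "\<And>x. x \<in> f ` carrier M \<Longrightarrow> \<ominus>\<^bsub>N\<^esub> x \<in> f ` carrier M"
proof -
  interpret M: left_module R M by fact
  show "f ` carrier M \<subseteq> carrier N" using mod_hom_closed[OF f] by auto
  show "\<zero>\<^bsub>N\<^esub> \<in> f ` carrier M"
    using mod_hom_zero[OF assms] M.M.zero_closed by (metis imageI)
  show "x \<oplus>\<^bsub>N\<^esub> y \<in> f ` carrier M" if "x \<in> f ` carrier M" "y \<in> f ` carrier M" for x y
    using that by (auto simp flip: mod_hom_add[OF f])
  show "a \<odot>\<^bsub>N\<^esub> x \<in> f ` carrier M" if "a \<in> carrier R" "x \<in> f ` carrier M" for a x
    using that by (auto simp flip: mod_hom_smult[OF f] simp: M.smult_closed)
  show "\<ominus>\<^bsub>N\<^esub> x \<in> f ` carrier M" if "x \<in> f ` carrier M" for x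
    using that by (auto simp flip: mod_hom_neg[OF assms])
qed

text \<open>Serves the minimality of a projective cover, which is a condition on the submodules of
  its source.\<close>

lemma submodule_image:
  assumes "left_module R M" "left_module R N" and f: "f \<in> mod_hom R M N"
  shows "submodule (f ` carrier M) R N"
  using image_closed[OF assms]
  by (intro submodule.intro subgroup.intro submodule_axioms.intro) (simp_all flip: a_inv_def)

lemma left_module_image:
  assumes "left_module R M" "left_module R N" "f \<in> mod_hom R M N"
  shows "left_module R (N\<lparr>carrier := f ` carrier M\<rparr>)"
  by (rule left_module_subset[OF assms(2)]) (rule image_closed[OF assms]; assumption?)+

text \<open>The images of a finite generating family generate, since a homomorphism commutes with
  finite sums and scalars.\<close>

lemma fg_surjective_image:
  assumes M: "fg_module R M" and N: "left_module R N" and f: "f \<in> mod_hom R M N"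
    and surj: "f ` carrier M = carrier N"
  shows "fg_module R N"
proof -
  interpret M: left_module R M using M by (rule fg_imp_left_module)
  interpret N: left_module R N by fact
  obtain n :: nat and s where s: "s \<in> {..<n} \<rightarrow> carrier M"
    "\<And>x. x \<in> carrier M \<Longrightarrow> \<exists>c \<in> {..<n} \<rightarrow> carrier R. x = (\<Oplus>\<^bsub>M\<^esub>i\<in>{..<n}. c i \<odot>\<^bsub>M\<^esub> s i)"
    using M unfolding fg_module_def by blast
  show ?thesis
    unfolding fg_module_def
  proof (intro conjI N exI[of _ n] exI[of _ "\<lambda>i. f (s i)"] ballI)
    show "(\<lambda>i. f (s i)) \<in> {..<n} \<rightarrow> carrier N" using s(1) mod_hom_closed[OF f] by auto
  next
    fix y assume "y \<in> carrier N"
    then obtain x where x: "x \<in> carrier M" "y = f x" using surj by auto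
    obtain c where c: "c \<in> {..<n} \<rightarrow> carrier R" "x = (\<Oplus>\<^bsub>M\<^esub>i\<in>{..<n}. c i \<odot>\<^bsub>M\<^esub> s i)"
      using s(2)[OF x(1)] by blast
    have cs: "c i \<in> carrier R" "s i \<in> carrier M" if "i \<in> {..<n}" for i
      using c(1) s(1) that by auto
    have "y = (\<Oplus>\<^bsub>N\<^esub>i\<in>{..<n}. f (c i \<odot>\<^bsub>M\<^esub> s i))"
      unfolding x(2) c(2) using cs
      by (intro mod_hom_finsum[OF M.left_module_axioms N f]) (auto intro!: M.smult_closed)
    also have "\<dots> = (\<Oplus>\<^bsub>N\<^esub>i\<in>{..<n}. c i \<odot>\<^bsub>N\<^esub> f (s i))"
      using cs mod_hom_closed[OF f]
      by (intro N.M.finsum_cong' Pi_I refl) (simp_all add: mod_hom_smult[OF f] N.smult_closed)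
    finally show "\<exists>c \<in> {..<n} \<rightarrow> carrier R. y = (\<Oplus>\<^bsub>N\<^esub>i\<in>{..<n}. c i \<odot>\<^bsub>N\<^esub> f (s i))"
      using c(1) by blast
  qed
qed

text \<open>Realizes the quotient by the relation \<open>e x = e y\<close> on the image of
  \<open>e\<close>, with operations computed on chosen preimages; the hypotheses on \<open>e\<close>
  make the results independent of the choice.\<close>

lemma quotient_by_congruence:
  fixes M :: "('a, 'm) module" and e :: "'m \<Rightarrow> 'n"
  assumes "left_module R M"
    and add: "\<And>x x' y y'. \<lbrakk>x \<in> carrier M; x' \<in> carrier M; y \<in> carrier M; y' \<in> carrier M;
      e x = e x'; e y = e y'\<rbrakk> \<Longrightarrow> e (x \<oplus>\<^bsub>M\<^esub> y) = e (x' \<oplus>\<^bsub>M\<^esub> y')"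
    and smult: "\<And>a x x'. \<lbrakk>a \<in> carrier R; x \<in> carrier M; x' \<in> carrier M; e x = e x'\<rbrakk> \<Longrightarrow>
      e (a \<odot>\<^bsub>M\<^esub> x) = e (a \<odot>\<^bsub>M\<^esub> x')"
  shows "\<exists>N :: ('a, 'n) module. left_module R N \<and> e \<in> mod_hom R M N \<and> carrier N = e ` carrier M"
proof -
  interpret M: left_module R M by fact
  define d where "d = inv_into (carrier M) e"
  have d[simp]: "d (e x) \<in> carrier M" "e (d (e x)) = e x" if "x \<in> carrier M" for x
    using that by (auto simp: d_def inv_into_into f_inv_into_f)
  define N :: "('a, 'n) module" where
    "N = \<lparr>carrier = e ` carrier M, mult = (\<lambda>x y. x), one = e \<zero>\<^bsub>M\<^esub>, zero = e \<zero>\<^bsub>M\<^esub>,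
      add = (\<lambda>x y. e (d x \<oplus>\<^bsub>M\<^esub> d y)), smult = (\<lambda>a x. e (a \<odot>\<^bsub>M\<^esub> d x))\<rparr>"
  have N[simp]: "carrier N = e ` carrier M" "\<zero>\<^bsub>N\<^esub> = e \<zero>\<^bsub>M\<^esub>"
    by (simp_all add: N_def)
  have Nadd[simp]: "e x \<oplus>\<^bsub>N\<^esub> e y = e (x \<oplus>\<^bsub>M\<^esub> y)" if "x \<in> carrier M" "y \<in> carrier M" for x y
    using that by (auto simp: N_def intro!: add)
  have Nsmult[simp]: "a \<odot>\<^bsub>N\<^esub> e x = e (a \<odot>\<^bsub>M\<^esub> x)" if "a \<in> carrier R" "x \<in> carrier M" for a x
    using that by (auto simp: N_def intro!: smult)
  have "abelian_group N"
  proof (rule abelian_groupI)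
    fix x assume "x \<in> carrier N"
    then obtain y where y: "y \<in> carrier M" "x = e y" by auto
    then have "e (\<ominus>\<^bsub>M\<^esub> y) \<oplus>\<^bsub>N\<^esub> x = \<zero>\<^bsub>N\<^esub>" by (simp add: M.M.l_neg)
    then show "\<exists>y\<in>carrier N. y \<oplus>\<^bsub>N\<^esub> x = \<zero>\<^bsub>N\<^esub>"
      using y by (intro bexI[of _ "e (\<ominus>\<^bsub>M\<^esub> y)"]) auto
  qed (auto simp: M.M.add.m_ac)
  then have "left_module R N"
    by (intro left_module.intro left_module_axioms.intro M.R.ring_axioms)
      (auto simp: M.smult_closed M.smult_l_distr M.smult_r_distr M.smult_assoc M.smult_one)
  moreover have "e \<in> mod_hom R M N" by (rule mod_homI) auto
  ultimately show ?thesis by (intro exI[of _ N]) simp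
qed

text \<open>The cosets of the image form a finitely generated module, which is then moved to the
  small carrier type so that the cokernel can serve as a test object for almost split maps.\<close>

lemma small_cokernel:
  fixes M :: "('a, 'm) module" and N :: "('a, 'n) module"
  assumes "left_module R M" and N: "fg_module R N" and f: "f \<in> mod_hom R M N"
  shows "\<exists>(K :: ('a, 'a small) module) \<pi>. fg_module R K \<and> \<pi> \<in> mod_hom R N K \<and>
    \<pi> ` carrier N = carrier K \<and> mod_kernel N K \<pi> = f ` carrier M"
proof -
  interpret M: left_module R M by fact
  interpret N: left_module R N using N by (rule fg_imp_left_module)
  let ?I = "f ` carrier M"
  note I = image_closed[OF assms(1) N.left_module_axioms f]
  \<comment> \<open>The coset of \<open>x\<close> modulo the image; \<open>e_iff\<close> turns
    equality of cosets into membership of the difference.\<close>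
  define e where "e x = {y \<in> carrier N. x \<ominus>\<^bsub>N\<^esub> y \<in> ?I}" for x
  have e_iff: "e x = e y \<longleftrightarrow> x \<ominus>\<^bsub>N\<^esub> y \<in> ?I" if x: "x \<in> carrier N" and y: "y \<in> carrier N" for x y
  proof
    assume "e x = e y"
    moreover have "y \<in> e y" using y I(2) by (simp add: e_def N.M.minus_self)
    ultimately show "x \<ominus>\<^bsub>N\<^esub> y \<in> ?I" by (auto simp: e_def)
  next
    assume xy: "x \<ominus>\<^bsub>N\<^esub> y \<in> ?I"
    then have yx: "y \<ominus>\<^bsub>N\<^esub> x \<in> ?I" using I(5)[OF xy] x y by (simp add: N.M.neg_minus)
    have "x \<ominus>\<^bsub>N\<^esub> z \<in> ?I \<longleftrightarrow> y \<ominus>\<^bsub>N\<^esub> z \<in> ?I" if z: "z \<in> carrier N" for z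
      using I(3)[OF xy, of "y \<ominus>\<^bsub>N\<^esub> z"] I(3)[OF yx, of "x \<ominus>\<^bsub>N\<^esub> z"] x y z
      by (auto simp only: N.M.minus_trans)
    then show "e x = e y" by (auto simp: e_def)
  qed
  obtain L :: "('a, 'n set) module" where
    L: "left_module R L" "e \<in> mod_hom R N L" "carrier L = e ` carrier N"
  proof (rule exE[OF quotient_by_congruence[OF N.left_module_axioms, of e]])
    fix x x' y y'
    assume *: "x \<in> carrier N" "x' \<in> carrier N" "y \<in> carrier N" "y' \<in> carrier N"
      "e x = e x'" "e y = e y'"
    then show "e (x \<oplus>\<^bsub>N\<^esub> y) = e (x' \<oplus>\<^bsub>N\<^esub> y')"
      using I(3) by (simp add: e_iff N.M.add_minus_add)
  next
    fix a x x'
    assume *: "a \<in> carrier R" "x \<in> carrier N" "x' \<in> carrier N" "e x = e x'"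
    \<comment> \<open>Splitting off the difference yields \<open>a x - a x' = a (x - x')\<close>
      from right distributivity and the group laws, without first relating scalars to
      negation.\<close>
    have "a \<odot>\<^bsub>N\<^esub> x = a \<odot>\<^bsub>N\<^esub> (x \<ominus>\<^bsub>N\<^esub> x') \<oplus>\<^bsub>N\<^esub> a \<odot>\<^bsub>N\<^esub> x'"
      using * by (simp add: N.M.minus_add_cancel flip: N.smult_r_distr)
    then have "a \<odot>\<^bsub>N\<^esub> x \<ominus>\<^bsub>N\<^esub> a \<odot>\<^bsub>N\<^esub> x' = a \<odot>\<^bsub>N\<^esub> (x \<ominus>\<^bsub>N\<^esub> x')"
      using * by (simp add: N.M.minus_eq N.M.a_assoc N.M.r_neg N.smult_closed)
    then show "e (a \<odot>\<^bsub>N\<^esub> x) = e (a \<odot>\<^bsub>N\<^esub> x')"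
      using * I(4) by (simp add: e_iff N.smult_closed)
  qed auto
  have "fg_module R L" using fg_surjective_image[OF N L(1,2)] L(3) by simp
  then obtain K :: "('a, 'a small) module" and b where
    K: "fg_module R K" "b \<in> mod_hom R L K" "bij_betw b (carrier L) (carrier K)"
    using small_representative by metis
  define \<pi> where "\<pi> x = b (e x)" for x
  have \<pi>: "\<pi> \<in> mod_hom R N K" unfolding \<pi>_def by (rule mod_hom_comp[OF L(2) K(2)])
  have "\<pi> ` carrier N = b ` carrier L" by (auto simp: \<pi>_def L(3))
  then have surj: "\<pi> ` carrier N = carrier K" using K(3) by (simp add: bij_betw_def)
  have "\<pi> x = \<zero>\<^bsub>K\<^esub> \<longleftrightarrow> x \<in> ?I" if x: "x \<in> carrier N" for x
  proof -
    have "\<pi> x = \<zero>\<^bsub>K\<^esub> \<longleftrightarrow> \<pi> x = \<pi> \<zero>\<^bsub>N\<^esub>"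
      using mod_hom_zero[OF N.left_module_axioms fg_imp_left_module[OF K(1)] \<pi>] by simp
    also have "\<dots> \<longleftrightarrow> e x = e \<zero>\<^bsub>N\<^esub>"
      using K(3) x by (auto simp: \<pi>_def L(3) bij_betw_def inj_on_def)
    also have "\<dots> \<longleftrightarrow> x \<in> ?I"
      using x by (simp add: e_iff N.M.minus_zero_right)
    finally show ?thesis .
  qed
  then have "mod_kernel N K \<pi> = ?I" using I(1) by (auto simp: mod_kernel_def)
  with K(1) \<pi> surj show ?thesis by blast
qed

section \<open>Direct sums and projective modules\<close>

lemma direct_sum_simps [simp]:
  "carrier (direct_sum M N) = carrier M \<times> carrier N"
  "\<zero>\<^bsub>direct_sum M N\<^esub> = (\<zero>\<^bsub>M\<^esub>, \<zero>\<^bsub>N\<^esub>)"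
  "(x, y) \<oplus>\<^bsub>direct_sum M N\<^esub> (x', y') = (x \<oplus>\<^bsub>M\<^esub> x', y \<oplus>\<^bsub>N\<^esub> y')"
  "a \<odot>\<^bsub>direct_sum M N\<^esub> (x, y) = (a \<odot>\<^bsub>M\<^esub> x, a \<odot>\<^bsub>N\<^esub> y)"
  by (simp_all add: direct_sum_def)

lemma left_module_direct_sum:
  assumes "left_module R M" "left_module R N"
  shows "left_module R (direct_sum M N)"
proof -
  interpret M: left_module R M by fact
  interpret N: left_module R N by fact
  have "abelian_group (direct_sum M N)"
  proof (rule abelian_groupI)
    fix x assume "x \<in> carrier (direct_sum M N)"
    then show "\<exists>y \<in> carrier (direct_sum M N). y \<oplus>\<^bsub>direct_sum M N\<^esub> x = \<zero>\<^bsub>direct_sum M N\<^esub>"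
      by (intro bexI[of _ "(\<ominus>\<^bsub>M\<^esub> fst x, \<ominus>\<^bsub>N\<^esub> snd x)"]) (auto simp: M.M.l_neg N.M.l_neg)
  qed (auto simp: M.M.add.m_ac N.M.add.m_ac)
  then show ?thesis
    by (intro left_module.intro left_module_axioms.intro M.R.ring_axioms)
      (auto simp: M.smult_closed M.smult_l_distr M.smult_r_distr M.smult_assoc M.smult_one
        N.smult_closed N.smult_l_distr N.smult_r_distr N.smult_assoc N.smult_one)
qed

lemma mod_hom_snd: "snd \<in> mod_hom R (direct_sum M N) N"
  by (rule mod_homI) auto

lemma mod_hom_inl:
  assumes "left_module R N"
  shows "(\<lambda>x. (x, \<zero>\<^bsub>N\<^esub>)) \<in> mod_hom R M (direct_sum M N)"
proof -
  interpret N: left_module R N by fact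
  show ?thesis by (rule mod_homI) (auto simp: N.smult_zero)
qed

lemma mod_hom_inr:
  assumes "left_module R M"
  shows "(\<lambda>y. (\<zero>\<^bsub>M\<^esub>, y)) \<in> mod_hom R N (direct_sum M N)"
proof -
  interpret M: left_module R M by fact
  show ?thesis by (rule mod_homI) (auto simp: M.smult_zero)
qed

lemma mod_hom_copair:
  assumes "left_module R L" and f: "f \<in> mod_hom R M L" and g: "g \<in> mod_hom R N L"
  shows "(\<lambda>x. f (fst x) \<oplus>\<^bsub>L\<^esub> g (snd x)) \<in> mod_hom R (direct_sum M N) L"
proof (rule mod_hom_add_fun[OF assms(1)])
  show "(\<lambda>x. g (snd x)) \<in> mod_hom R (direct_sum M N) L" by (rule mod_hom_comp[OF mod_hom_snd g])
  have "fst \<in> mod_hom R (direct_sum M N) M" by (rule mod_homI) auto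
  then show "(\<lambda>x. f (fst x)) \<in> mod_hom R (direct_sum M N) L" by (rule mod_hom_comp[OF _ f])
qed

lemma mod_hom_direct_sum_split:
  assumes "left_module R M" "left_module R N" and f: "f \<in> mod_hom R (direct_sum M N) L"
    and x: "x \<in> carrier M" and y: "y \<in> carrier N"
  shows "f (x, y) = f (x, \<zero>\<^bsub>N\<^esub>) \<oplus>\<^bsub>L\<^esub> f (\<zero>\<^bsub>M\<^esub>, y)"
proof -
  interpret M: left_module R M by fact
  interpret N: left_module R N by fact
  show ?thesis using mod_hom_add[OF f, of "(x, \<zero>\<^bsub>N\<^esub>)" "(\<zero>\<^bsub>M\<^esub>, y)"] x y by simp
qed

text \<open>Generators of both summands, padded with a zero in the other coordinate, generate the
  sum. The families are concatenated because generators are indexed by an initial segment of the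
  naturals.\<close>

lemma fg_direct_sum:
  assumes M: "fg_module R M" and N: "fg_module R N"
  shows "fg_module R (direct_sum M N)"
proof -
  let ?S = "direct_sum M N"
  interpret M: left_module R M using M by (rule fg_imp_left_module)
  interpret N: left_module R N using N by (rule fg_imp_left_module)
  interpret S: left_module R ?S
    by (rule left_module_direct_sum[OF M.left_module_axioms N.left_module_axioms])
  note inl = mod_hom_inl[OF N.left_module_axioms, of M]
  note inr = mod_hom_inr[OF M.left_module_axioms, of N]
  obtain m :: nat and s where s: "s \<in> {..<m} \<rightarrow> carrier M"
    "\<And>x. x \<in> carrier M \<Longrightarrow> \<exists>c \<in> {..<m} \<rightarrow> carrier R. x = (\<Oplus>\<^bsub>M\<^esub>i\<in>{..<m}. c i \<odot>\<^bsub>M\<^esub> s i)"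
    using M unfolding fg_module_def by blast
  obtain n :: nat and t where t: "t \<in> {..<n} \<rightarrow> carrier N"
    "\<And>x. x \<in> carrier N \<Longrightarrow> \<exists>c \<in> {..<n} \<rightarrow> carrier R. x = (\<Oplus>\<^bsub>N\<^esub>i\<in>{..<n}. c i \<odot>\<^bsub>N\<^esub> t i)"
    using N unfolding fg_module_def by blast
  define g where "g i = (if i < m then (s i, \<zero>\<^bsub>N\<^esub>) else (\<zero>\<^bsub>M\<^esub>, t (i - m)))" for i
  \<comment> \<open>The length \<open>n\<close> is generalized here, so that the induction runs over
    the second family while the first stays fixed.\<close>
  have concat: "(\<Oplus>\<^bsub>?S\<^esub>i\<in>{..<m + n}. if i < m then a i else b (i - m))
      = (\<Oplus>\<^bsub>?S\<^esub>i\<in>{..<m}. a i) \<oplus>\<^bsub>?S\<^esub> (\<Oplus>\<^bsub>?S\<^esub>i\<in>{..<n}. b i)"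
    if "a \<in> {..<m} \<rightarrow> carrier ?S" "b \<in> {..<n} \<rightarrow> carrier ?S" for n a b
    using that(2)
  proof (induction n)
    case 0
    have "(\<Oplus>\<^bsub>?S\<^esub>i\<in>{..<m}. if i < m then a i else b (i - m)) = (\<Oplus>\<^bsub>?S\<^esub>i\<in>{..<m}. a i)"
      using that(1) by (intro S.M.finsum_cong') auto
    then show ?case
      using S.M.r_zero[OF S.M.finsum_closed[OF that(1)]]
      by (simp only: add_0_right lessThan_0 S.M.finsum_empty)
  next
    case (Suc n)
    then have b: "b \<in> {..<n} \<rightarrow> carrier ?S" "b n \<in> carrier ?S" by (simp_all only: Pi_iff) simp_all
    have ab: "(\<lambda>i. if i < m then a i else b (i - m)) \<in> {..<m + n} \<rightarrow> carrier ?S"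
      using that(1) b(1) by (auto simp: Pi_iff)
    have "(\<Oplus>\<^bsub>?S\<^esub>i\<in>{..<m + Suc n}. if i < m then a i else b (i - m))
        = b n \<oplus>\<^bsub>?S\<^esub> (\<Oplus>\<^bsub>?S\<^esub>i\<in>{..<m + n}. if i < m then a i else b (i - m))"
      using ab b(2) by (simp add: lessThan_Suc S.M.finsum_insert del: direct_sum_simps)
    moreover have "(\<Oplus>\<^bsub>?S\<^esub>i\<in>{..<Suc n}. b i) = b n \<oplus>\<^bsub>?S\<^esub> (\<Oplus>\<^bsub>?S\<^esub>i\<in>{..<n}. b i)"
      using b by (simp add: lessThan_Suc S.M.finsum_insert del: direct_sum_simps)
    ultimately show ?case
      using Suc.IH[OF b(1)] S.M.finsum_closed[OF that(1)] S.M.finsum_closed[OF b(1)] b(2)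
      by (simp add: S.M.add.m_lcomm del: direct_sum_simps)
  qed
  show ?thesis
    unfolding fg_module_def
  proof (intro conjI S.left_module_axioms exI[of _ "m + n"] exI[of _ g] ballI)
    show "g \<in> {..<m + n} \<rightarrow> carrier ?S" using s(1) t(1) by (auto simp: g_def Pi_iff)
  next
    fix z assume "z \<in> carrier ?S"
    then obtain x y where z: "z = (x, y)" "x \<in> carrier M" "y \<in> carrier N" by auto
    obtain c where c: "c \<in> {..<m} \<rightarrow> carrier R" "x = (\<Oplus>\<^bsub>M\<^esub>i\<in>{..<m}. c i \<odot>\<^bsub>M\<^esub> s i)"
      using s(2)[OF z(2)] by blast
    obtain c' where c': "c' \<in> {..<n} \<rightarrow> carrier R" "y = (\<Oplus>\<^bsub>N\<^esub>i\<in>{..<n}. c' i \<odot>\<^bsub>N\<^esub> t i)"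
      using t(2)[OF z(3)] by blast
    define a where "a i = (c i \<odot>\<^bsub>M\<^esub> s i, \<zero>\<^bsub>N\<^esub>)" for i
    define b where "b i = (\<zero>\<^bsub>M\<^esub>, c' i \<odot>\<^bsub>N\<^esub> t i)" for i
    define k where "k i = (if i < m then c i else c' (i - m))" for i
    have cs: "(\<lambda>i. c i \<odot>\<^bsub>M\<^esub> s i) \<in> {..<m} \<rightarrow> carrier M"
      using c(1) s(1) by (auto simp: Pi_iff M.smult_closed)
    have ct: "(\<lambda>i. c' i \<odot>\<^bsub>N\<^esub> t i) \<in> {..<n} \<rightarrow> carrier N"
      using c'(1) t(1) by (auto simp: Pi_iff N.smult_closed)
    have ab: "a \<in> {..<m} \<rightarrow> carrier ?S" "b \<in> {..<n} \<rightarrow> carrier ?S"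
      using cs ct by (auto simp: a_def b_def Pi_iff)
    have k: "k \<in> {..<m + n} \<rightarrow> carrier R"
      using c(1) c'(1) by (auto simp: k_def Pi_iff)
    have "z = (x, \<zero>\<^bsub>N\<^esub>) \<oplus>\<^bsub>?S\<^esub> (\<zero>\<^bsub>M\<^esub>, y)" using z by simp
    also have "(x, \<zero>\<^bsub>N\<^esub>) = (\<Oplus>\<^bsub>?S\<^esub>i\<in>{..<m}. a i)"
      unfolding a_def c(2)
      by (rule mod_hom_finsum[OF M.left_module_axioms S.left_module_axioms inl cs])
    also have "(\<zero>\<^bsub>M\<^esub>, y) = (\<Oplus>\<^bsub>?S\<^esub>i\<in>{..<n}. b i)"
      unfolding b_def c'(2)
      by (rule mod_hom_finsum[OF N.left_module_axioms S.left_module_axioms inr ct])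
    also have "(\<Oplus>\<^bsub>?S\<^esub>i\<in>{..<m}. a i) \<oplus>\<^bsub>?S\<^esub> (\<Oplus>\<^bsub>?S\<^esub>i\<in>{..<n}. b i)
        = (\<Oplus>\<^bsub>?S\<^esub>i\<in>{..<m + n}. if i < m then a i else b (i - m))"
      by (rule concat[OF ab, symmetric])
    also have "\<dots> = (\<Oplus>\<^bsub>?S\<^esub>i\<in>{..<m + n}. k i \<odot>\<^bsub>?S\<^esub> g i)"
    proof (rule S.M.finsum_cong'[OF refl])
      have g: "g \<in> {..<m + n} \<rightarrow> carrier ?S" using s(1) t(1) by (auto simp: g_def Pi_iff)
      show "(\<lambda>i. k i \<odot>\<^bsub>?S\<^esub> g i) \<in> {..<m + n} \<rightarrow> carrier ?S"
        using k g S.smult_closed by blast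
      fix i assume i: "i \<in> {..<m + n}"
      show "(if i < m then a i else b (i - m)) = k i \<odot>\<^bsub>?S\<^esub> g i"
      proof (cases "i < m")
        case True
        then have "c i \<in> carrier R" "s i \<in> carrier M" using c(1) s(1) by auto
        then show ?thesis using True mod_hom_smult[OF inl, of "c i" "s i"]
          by (simp add: a_def k_def g_def)
      next
        case False
        with i have "c' (i - m) \<in> carrier R" "t (i - m) \<in> carrier N" using c'(1) t(1) by auto
        then show ?thesis using False mod_hom_smult[OF inr, of "c' (i - m)" "t (i - m)"]
          by (simp add: b_def k_def g_def)
      qed
    qed
    finally show "\<exists>c \<in> {..<m + n} \<rightarrow> carrier R. z = (\<Oplus>\<^bsub>?S\<^esub>i\<in>{..<m + n}. c i \<odot>\<^bsub>?S\<^esub> g i)"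
      using k by blast
  qed
qed

text \<open>Projectivity is defined by lifting along surjections between modules over the small
  type. Cutting \<open>Y\<close> down to the image of \<open>g\<close>, which is finitely generated
  because \<open>X\<close> is, and passing to small copies reduces the general case to that
  one.\<close>

lemma projective_lift:
  fixes X :: "('a, 'x) module" and Y :: "('a, 'y) module"
  assumes Q: "projective_module R Q" and X: "fg_module R X" and Y: "left_module R Y"
    and g: "g \<in> mod_hom R X Y" and t: "t \<in> mod_hom R Q Y"
    and im: "\<And>z. z \<in> carrier Q \<Longrightarrow> t z \<in> g ` carrier X"
  shows "\<exists>s \<in> mod_hom R Q X. \<forall>z \<in> carrier Q. g (s z) = t z"
proof -
  let ?I = "Y\<lparr>carrier := g ` carrier X\<rparr>"
  note X' = fg_imp_left_module[OF X]
  have I: "left_module R ?I" by (rule left_module_image[OF X' Y g])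
  have gI: "g \<in> mod_hom R X ?I"
    using g by (auto simp: mod_hom_def)
  have tI: "t \<in> mod_hom R Q ?I"
    using t im by (auto simp: mod_hom_def)
  have "fg_module R ?I" using fg_surjective_image[OF X I gI] by simp
  then obtain Z :: "('a, 'a small) module" and e where
    Z: "fg_module R Z" "e \<in> mod_hom R ?I Z" "bij_betw e (carrier ?I) (carrier Z)"
    using small_representative by metis
  obtain W :: "('a, 'a small) module" and b where
    W: "fg_module R W" "b \<in> mod_hom R X W" "bij_betw b (carrier X) (carrier W)"
    using small_representative[OF X] by metis
  obtain b' where b': "b' \<in> mod_hom R W X" "\<And>x. x \<in> carrier X \<Longrightarrow> b' (b x) = x"
    using mod_hom_inverse[OF X' fg_imp_left_module[OF W(1)] W(2,3)] by metis
  \<comment> \<open>The map \<open>g\<close> carried over to the small copies \<open>W\<close> of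
    \<open>X\<close> and \<open>Z\<close> of the image of \<open>g\<close>; it is onto because the
    target is only that image.\<close>
  define f where "f x = e (g (b' x))" for x
  have f: "f \<in> mod_hom R W Z"
    unfolding f_def by (rule mod_hom_comp[OF mod_hom_comp[OF b'(1) gI] Z(2)])
  have "f ` carrier W = f ` b ` carrier X" using W(3) by (simp add: bij_betw_def)
  also have "\<dots> = e ` carrier ?I" by (force simp: f_def b'(2))
  also have "\<dots> = carrier Z" using Z(3) by (simp add: bij_betw_def)
  finally have surj: "f ` carrier W = carrier Z" .
  obtain s where s: "s \<in> mod_hom R Q W" "\<And>z. z \<in> carrier Q \<Longrightarrow> f (s z) = e (t z)"
    using Q W(1) Z(1) f surj mod_hom_comp[OF tI Z(2)] unfolding projective_module_def by meson
  have "g (b' (s z)) = t z" if z: "z \<in> carrier Q" for z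
  proof (rule inj_onD[OF bij_betw_imp_inj_on[OF Z(3)]])
    show "e (g (b' (s z))) = e (t z)" using s(2)[OF z] by (simp add: f_def)
    show "g (b' (s z)) \<in> carrier ?I"
      using z by (intro mod_hom_closed[OF gI] mod_hom_closed[OF b'(1)] mod_hom_closed[OF s(1)])
    show "t z \<in> carrier ?I" using z by (rule mod_hom_closed[OF tI])
  qed
  then show ?thesis by (intro bexI[OF _ mod_hom_comp[OF s(1) b'(1)]]) simp
qed

text \<open>The restrictions of the test map to the two summands are lifted separately, and the
  lifts are added.\<close>

lemma projective_direct_sum:
  assumes M: "projective_module R M" and N: "projective_module R N"
  shows "projective_module R (direct_sum M N)"
  unfolding projective_module_def
proof (intro conjI allI impI; (elim conjE)?)
  have fg: "fg_module R M" "fg_module R N" using M N by (simp_all add: projective_module_def)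
  then show "fg_module R (direct_sum M N)" by (rule fg_direct_sum)
  note lm = fg[THEN fg_imp_left_module]
  fix X Y :: "('a, 'a small) module" and g t
  assume X: "fg_module R X" and Y: "fg_module R Y" and g: "g \<in> mod_hom R X Y"
    "g ` carrier X = carrier Y" and t: "t \<in> mod_hom R (direct_sum M N) Y"
  interpret X: left_module R X using X by (rule fg_imp_left_module)
  obtain a where a: "a \<in> mod_hom R M X" "\<And>x. x \<in> carrier M \<Longrightarrow> g (a x) = t (x, \<zero>\<^bsub>N\<^esub>)"
    using M X Y g mod_hom_comp[OF mod_hom_inl[OF lm(2)] t] unfolding projective_module_def by meson
  obtain b where b: "b \<in> mod_hom R N X" "\<And>x. x \<in> carrier N \<Longrightarrow> g (b x) = t (\<zero>\<^bsub>M\<^esub>, x)"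
    using N X Y g mod_hom_comp[OF mod_hom_inr[OF lm(1)] t] unfolding projective_module_def by meson
  show "\<exists>s \<in> mod_hom R (direct_sum M N) X. \<forall>x \<in> carrier (direct_sum M N). g (s x) = t x"
  proof (intro bexI ballI)
    show "(\<lambda>x. a (fst x) \<oplus>\<^bsub>X\<^esub> b (snd x)) \<in> mod_hom R (direct_sum M N) X"
      by (rule mod_hom_copair[OF X.left_module_axioms a(1) b(1)])
    fix z assume "z \<in> carrier (direct_sum M N)"
    then show "g (a (fst z) \<oplus>\<^bsub>X\<^esub> b (snd z)) = t z"
      using mod_hom_closed[OF a(1)] mod_hom_closed[OF b(1)]
      by (auto simp: mod_hom_add[OF g(1)] a(2) b(2) mod_hom_direct_sum_split[OF lm t])
  qed
qed

lemma left_module_zero_module: "ring R \<Longrightarrow> left_module R zero_module"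
  by (intro left_module.intro left_module_axioms.intro abelian_groupI)
    (simp_all add: zero_module_def)

lemma mod_hom_from_zero_module:
  assumes "left_module R X"
  shows "(\<lambda>_. \<zero>\<^bsub>X\<^esub>) \<in> mod_hom R zero_module X"
proof -
  interpret X: left_module R X by fact
  show ?thesis by (rule mod_homI) (simp_all add: X.smult_zero)
qed

lemma mod_hom_to_zero_module: "(\<lambda>_. ()) \<in> mod_hom R M zero_module"
  by (rule mod_homI) (simp_all add: zero_module_def)

lemma projective_zero_module:
  assumes "ring R"
  shows "projective_module R zero_module"
  unfolding projective_module_def
proof (intro conjI allI impI; (elim conjE)?)
  interpret Z: left_module R zero_module by (rule left_module_zero_module[OF assms])
  show "fg_module R zero_module"
    unfolding fg_module_def
    by (intro conjI Z.left_module_axioms exI[of _ 0] exI[of _ "\<lambda>_. ()"])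
      (simp_all add: zero_module_def)
  fix X Y :: "('a, 'a small) module" and g t
  assume XY: "fg_module R X" "fg_module R Y" and g: "g \<in> mod_hom R X Y"
    and t: "t \<in> mod_hom R zero_module Y"
  note lm = XY[THEN fg_imp_left_module]
  \<comment> \<open>The unit type has a single element, so \<open>x\<close> is the zero of
    \<open>zero_module\<close> and both sides vanish.\<close>
  have "g \<zero>\<^bsub>X\<^esub> = t x" for x
    using mod_hom_zero[OF lm g] mod_hom_zero[OF Z.left_module_axioms lm(2) t] by simp
  then show "\<exists>s \<in> mod_hom R zero_module X. \<forall>x \<in> carrier zero_module. g (s x) = t x"
    using mod_hom_from_zero_module[OF lm(1)] by (intro bexI[of _ "\<lambda>_. \<zero>\<^bsub>X\<^esub>"] ballI)
qed

text \<open>The image of \<open>e\<close> still maps onto \<open>M\<close>, so minimality makes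
  \<open>e\<close> surjective, and projectivity of \<open>Q\<close> splits it. The section is again
  compatible with \<open>p\<close>, which allows it to be used in a commuting square.\<close>

lemma projective_cover_section:
  assumes cov: "projective_cover R Q M p" and e: "e \<in> mod_hom R Q Q"
    and pe: "\<And>x. x \<in> carrier Q \<Longrightarrow> p (e x) = p x"
  shows "\<exists>m \<in> mod_hom R Q Q. \<forall>x \<in> carrier Q. e (m x) = x \<and> p (m x) = p x"
proof -
  have Q: "projective_module R Q" "fg_module R Q" and surj: "p ` carrier Q = carrier M"
    and min: "\<And>U. submodule U R Q \<Longrightarrow> p ` U = carrier M \<Longrightarrow> U = carrier Q"
    using cov by (auto simp: projective_cover_def projective_module_def)
  note lm = fg_imp_left_module[OF Q(2)]
  have "p ` e ` carrier Q = p ` carrier Q" using pe by (simp add: image_image)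
  then have im: "e ` carrier Q = carrier Q" using min[OF submodule_image[OF lm lm e]] surj by simp
  obtain m where m: "m \<in> mod_hom R Q Q" "\<And>x. x \<in> carrier Q \<Longrightarrow> e (m x) = x"
    using projective_lift[OF Q lm e mod_hom_id] im by auto
  \<comment> \<open>Apply \<open>pe\<close> at \<open>m x\<close> and use that
    \<open>e (m x)\<close> is \<open>x\<close>.\<close>
  then have "p (m x) = p x" if "x \<in> carrier Q" for x
    using pe[OF mod_hom_closed[OF m(1) that]] m(2)[OF that] by simp
  with m show ?thesis by (intro bexI[of _ m]) simp_all
qed

section \<open>The almost split sequence\<close>

theorem proposition5p9:
  fixes k :: "('k, 's) ring_scheme" and \<phi> :: "'k \<Rightarrow> 'a" and \<Lambda> :: "('a, 'r) ring_scheme"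
    and P :: "('a, 'p) module" and B :: "('a, 'b) module" and C :: "('a, 'c) module"
    and Q0 :: "('a, 'q0) module" and Q1 :: "('a, 'q1) module" and \<Omega> :: "('a, 'q0) module"
    and u :: "'p \<Rightarrow> 'b" and v :: "'b \<Rightarrow> 'c" and q :: "'q0 \<Rightarrow> 'c" and i :: "'q0 \<Rightarrow> 'q0"
    and h :: "'q0 \<Rightarrow> 'p \<times> 'q0" and d :: "'p \<times> 'q0 \<Rightarrow> 'b" and j :: "'q1 \<Rightarrow> 'q0"
  assumes artin: "artin_algebra k \<phi> \<Lambda>"
    and P: "indecomposable_module \<Lambda> P" "projective_module \<Lambda> P" "\<not> injective_module \<Lambda> P"
    and C: "is_inverse_AR_translate k \<phi> \<Lambda> P C"
    and ass: "almost_split \<Lambda> P u B v C"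
    and Q0: "projective_cover \<Lambda> Q0 C q"
    and Omega_def: "\<Omega> = kernel_module Q0 C q"
    and i_def: "i = (\<lambda>x. x)"
    and pullback: "is_pullback \<Lambda> B v Q0 q (direct_sum P Q0) d snd"
    and left_square: "\<forall>x \<in> carrier P. d (x, \<zero>\<^bsub>Q0\<^esub>) = u x"
    and top_square: "\<forall>x \<in> carrier \<Omega>. snd (h x) = i x"
    and column: "short_exact \<Lambda> \<Omega> h (direct_sum P Q0) d B"
    and Q1: "projective_cover \<Lambda> Q1 \<Omega> j"
  shows "almost_split_in_H \<Lambda>
           (Mor zero_module (\<lambda>_. \<zero>\<^bsub>P\<^esub>) P)
           (\<lambda>_. \<zero>\<^bsub>Q1\<^esub>, \<lambda>x. (x, \<zero>\<^bsub>Q0\<^esub>))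
           (Mor Q1 (h \<circ> j) (direct_sum P Q0))
           (\<lambda>x. x, snd)
           (Mor Q1 (i \<circ> j) Q0)
       \<and> almost_split_in_P \<Lambda>
           (Mor zero_module (\<lambda>_. \<zero>\<^bsub>P\<^esub>) P)
           (\<lambda>_. \<zero>\<^bsub>Q1\<^esub>, \<lambda>x. (x, \<zero>\<^bsub>Q0\<^esub>))
           (Mor Q1 (h \<circ> j) (direct_sum P Q0))
           (\<lambda>x. x, snd)
           (Mor Q1 (i \<circ> j) Q0)"
proof -
  let ?S = "direct_sum P Q0"
  let ?A = "Mor zero_module (\<lambda>_. \<zero>\<^bsub>P\<^esub>) P" and ?f = "(\<lambda>_ :: unit. \<zero>\<^bsub>Q1\<^esub>, \<lambda>x :: 'p. (x, \<zero>\<^bsub>Q0\<^esub>))"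
  let ?E = "Mor Q1 (h \<circ> j) ?S" and ?g = "(\<lambda>x :: 'q1. x, snd :: 'p \<times> 'q0 \<Rightarrow> 'q0)"
  let ?D = "Mor Q1 (i \<circ> j) Q0"

  \<comment> \<open>Modules and maps of the diagram\<close>
  have proj: "projective_module \<Lambda> Q0" "projective_module \<Lambda> Q1"
    using Q0 Q1 by (simp_all add: projective_cover_def)
  have fg: "fg_module \<Lambda> P" "fg_module \<Lambda> B" "fg_module \<Lambda> C" "fg_module \<Lambda> Q0" "fg_module \<Lambda> Q1"
    "fg_module \<Lambda> \<Omega>" "fg_module \<Lambda> ?S"
    using ass Q0 Q1 by (auto simp: almost_split_def projective_cover_def projective_module_def
        intro: fg_direct_sum)
  interpret P: left_module \<Lambda> P by (rule fg_imp_left_module[OF fg(1)])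
  interpret B: left_module \<Lambda> B by (rule fg_imp_left_module[OF fg(2)])
  interpret C: left_module \<Lambda> C by (rule fg_imp_left_module[OF fg(3)])
  interpret Q0: left_module \<Lambda> Q0 by (rule fg_imp_left_module[OF fg(4)])
  interpret Q1: left_module \<Lambda> Q1 by (rule fg_imp_left_module[OF fg(5)])
  interpret \<Omega>: left_module \<Lambda> \<Omega> by (rule fg_imp_left_module[OF fg(6)])
  interpret S: left_module \<Lambda> ?S by (rule fg_imp_left_module[OF fg(7)])
  note lm = P.left_module_axioms B.left_module_axioms C.left_module_axioms Q0.left_module_axioms
    Q1.left_module_axioms S.left_module_axioms

  have u: "u \<in> mod_hom \<Lambda> P B" and v: "v \<in> mod_hom \<Lambda> B C"
    and las: "left_almost_split \<Lambda> P B u" and ras: "right_almost_split \<Lambda> B C v"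
    using ass by (auto simp: almost_split_def short_exact_def)
  have q: "q \<in> mod_hom \<Lambda> Q0 C" "q ` carrier Q0 = carrier C"
    using Q0 by (auto simp: projective_cover_def)
  have \<Omega>: "carrier \<Omega> = {x \<in> carrier Q0. q x = \<zero>\<^bsub>C\<^esub>}" "\<zero>\<^bsub>\<Omega>\<^esub> = \<zero>\<^bsub>Q0\<^esub>"
    by (auto simp: Omega_def kernel_module_def mod_kernel_def)
  have incl: "(\<lambda>x. x) \<in> mod_hom \<Lambda> \<Omega> Q0"
    by (rule mod_homI) (auto simp: Omega_def kernel_module_def mod_kernel_def)
  have j: "j \<in> mod_hom \<Lambda> Q1 \<Omega>" "j ` carrier Q1 = carrier \<Omega>"
    using Q1 by (auto simp: projective_cover_def)
  \<comment> \<open>Since \<open>i\<close> is the identity function, the composite of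
    \<open>i\<close> and \<open>j\<close> is the function \<open>j\<close> with the larger codomain
    \<open>Q0\<close>.\<close>
  have ij: "j \<in> mod_hom \<Lambda> Q1 Q0" using mod_hom_comp[OF j(1) incl] by simp
  have h: "h \<in> mod_hom \<Lambda> \<Omega> ?S" and d: "d \<in> mod_hom \<Lambda> ?S B" "d ` carrier ?S = carrier B"
    and ker_d: "h ` carrier \<Omega> = mod_kernel ?S B d"
    using column by (auto simp: short_exact_def)
  have hj: "(\<lambda>x. h (j x)) \<in> mod_hom \<Lambda> Q1 ?S" by (rule mod_hom_comp[OF j(1) h])
  have dh: "d (h x) = \<zero>\<^bsub>B\<^esub>" if "x \<in> carrier \<Omega>" for x
    using ker_d that by (auto simp: mod_kernel_def)
  have jcl: "j x \<in> carrier \<Omega>" "j x \<in> carrier Q0" "q (j x) = \<zero>\<^bsub>C\<^esub>" if "x \<in> carrier Q1" for x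
    using mod_hom_closed[OF j(1) that] by (auto simp: \<Omega>)
  have snd_h: "snd (h x) = x" if "x \<in> carrier \<Omega>" for x
    using top_square that by (simp add: i_def)
  have vd: "v (d w) = q (snd w)" if "w \<in> carrier ?S" for w
    using pullback that unfolding is_pullback_def by blast
  \<comment> \<open>The universal property of the pull-back with its premises separated: the first
    conjunct of its conclusion is existence of the mediating map, the second is uniqueness.\<close>
  note pb = pullback[unfolded is_pullback_def, THEN conjunct2, THEN conjunct2, THEN conjunct2,
      THEN spec, THEN spec, THEN spec, THEN mp, OF conjI, OF _ conjI, OF _ _ conjI]
  note inl = mod_hom_inl[OF Q0.left_module_axioms, of P]

  \<comment> \<open>The three objects, the two morphisms and exactness\<close>
  have objs: "P_obj \<Lambda> ?A" "P_obj \<Lambda> ?E" "P_obj \<Lambda> ?D"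
    using fg proj P(2) projective_zero_module[OF P.R.ring_axioms]
      mod_hom_from_zero_module[OF P.left_module_axioms] hj ij projective_direct_sum[OF P(2) proj(1)]
    by (auto simp: P_obj_def H_obj_def i_def comp_def projective_module_def)
  have f: "?f \<in> H_hom \<Lambda> ?A ?E"
    using mod_hom_from_zero_module[OF Q1.left_module_axioms] inl
      mod_hom_zero[OF Q1.left_module_axioms S.left_module_axioms hj]
    by (auto simp: H_hom_def)
  have g: "?g \<in> H_hom \<Lambda> ?E ?D"
    using mod_hom_id[of \<Lambda> Q1] mod_hom_snd[of \<Lambda> P Q0] snd_h jcl
    by (auto simp: H_hom_def i_def)
  \<comment> \<open>On sources the sequence is \<open>0 -> Q1 = Q1\<close>, on targets the canonical
    sequence of the direct sum.\<close>
  have exact: "H_short_exact \<Lambda> ?A ?f ?E ?g ?D"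
    using f g
    by (auto simp: H_short_exact_def short_exact_def H_hom_def mod_kernel_def zero_module_def
        inj_on_def image_iff)

  \<comment> \<open>The first morphism does not split\<close>
  have not_mono: "\<not> H_split_mono \<Lambda> ?A ?E ?f"
  proof
    assume "H_split_mono \<Lambda> ?A ?E ?f"
    then obtain r where r: "r \<in> mod_hom \<Lambda> ?S P"
      "\<And>x. x \<in> carrier Q1 \<Longrightarrow> r (h (j x)) = \<zero>\<^bsub>P\<^esub>" "\<And>x. x \<in> carrier P \<Longrightarrow> r (x, \<zero>\<^bsub>Q0\<^esub>) = x"
      by (auto simp: H_split_mono_def H_hom_def H_comp_eq_def H_id_def)
    \<comment> \<open>As \<open>j\<close> is onto \<open>\<Omega>\<close>, the kernel of
      \<open>d\<close> is the image of \<open>h j\<close>, which \<open>r\<close> kills because a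
      retraction commutes with the arrows. Hence \<open>r\<close> factors through \<open>d\<close>,
      and the factor is a retraction of \<open>u\<close>.\<close>
    have "r w = \<zero>\<^bsub>P\<^esub>" if "w \<in> carrier ?S" "d w = \<zero>\<^bsub>B\<^esub>" for w
    proof -
      have "w \<in> h ` j ` carrier Q1" using that ker_d j(2) by (simp add: mod_kernel_def)
      then show ?thesis using r(2) by auto
    qed
    then obtain r' where r': "r' \<in> mod_hom \<Lambda> B P" "\<And>w. w \<in> carrier ?S \<Longrightarrow> r' (d w) = r w"
      using mod_hom_factor[OF lm(6,2,1) d r(1)] by blast
    have "r' (u x) = x" if x: "x \<in> carrier P" for x
      using r'(2)[of "(x, \<zero>\<^bsub>Q0\<^esub>)"] r(3)[OF x] left_square x by simp
    then have "split_mono \<Lambda> P B u" using r'(1) by (auto simp: split_mono_def)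
    then show False using las by (simp add: left_almost_split_def)
  qed

  \<comment> \<open>Extending morphisms that start at \<open>0 -> P\<close>\<close>
  have left: "\<exists>s \<in> H_hom \<Lambda> ?E X. H_comp_eq ?A s ?f t"
    if X: "H_obj \<Lambda> X" and t: "t \<in> H_hom \<Lambda> ?A X" and nsplit: "\<not> H_split_mono \<Lambda> ?A X t"
    for X :: "('a, 'a small, 'a small) morph_obj" and t
  proof -
    define X1 X2 a t2 where "X1 = src X" and "X2 = tgt X" and "a = arr X" and "t2 = snd t"
    note X_defs = X1_def X2_def a_def t2_def
    have fgX: "fg_module \<Lambda> X1" "fg_module \<Lambda> X2" and a: "a \<in> mod_hom \<Lambda> X1 X2"
      using X by (simp_all add: H_obj_def X_defs)
    interpret X1: left_module \<Lambda> X1 by (rule fg_imp_left_module[OF fgX(1)])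
    interpret X2: left_module \<Lambda> X2 by (rule fg_imp_left_module[OF fgX(2)])
    have t2: "t2 \<in> mod_hom \<Lambda> P X2" and t1: "fst t \<in> mod_hom \<Lambda> zero_module X1"
      using t by (auto simp: H_hom_def X_defs)
    have t1_0: "fst t () = \<zero>\<^bsub>X1\<^esub>"
      using mod_hom_zero[OF left_module_zero_module[OF P.R.ring_axioms] X1.left_module_axioms t1]
      by (simp add: zero_module_def)
    obtain K :: "('a, 'a small) module" and \<pi> where K: "fg_module \<Lambda> K"
      and \<pi>: "\<pi> \<in> mod_hom \<Lambda> X2 K" "\<pi> ` carrier X2 = carrier K"
      and ker: "mod_kernel X2 K \<pi> = a ` carrier X1"
      using small_cokernel[OF X1.left_module_axioms fgX(2) a] by blast
    interpret K: left_module \<Lambda> K by (rule fg_imp_left_module[OF K])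
    have \<pi>a: "\<pi> (a x) = \<zero>\<^bsub>K\<^esub>" if "x \<in> carrier X1" for x
      using ker that by (auto simp: mod_kernel_def)
    have "\<not> split_mono \<Lambda> P K (\<lambda>x. \<pi> (t2 x))"
    proof
      assume "split_mono \<Lambda> P K (\<lambda>x. \<pi> (t2 x))"
      then obtain r where r: "r \<in> mod_hom \<Lambda> K P" "\<And>x. x \<in> carrier P \<Longrightarrow> r (\<pi> (t2 x)) = x"
        by (auto simp: split_mono_def)
      \<comment> \<open>The square commutes because \<open>\<pi>\<close> kills the image of
        \<open>a\<close>.\<close>
      have "(\<lambda>_. (), \<lambda>x. r (\<pi> x)) \<in> H_hom \<Lambda> X ?A"
        using mod_hom_comp[OF \<pi>(1) r(1)] \<pi>a mod_hom_zero[OF K.left_module_axioms lm(1) r(1)]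
        by (auto simp: H_hom_def mod_hom_to_zero_module simp flip: X_defs)
      moreover have "H_comp_eq ?A (\<lambda>_. (), \<lambda>x. r (\<pi> x)) t H_id"
        using r(2) by (simp add: H_comp_eq_def H_id_def flip: X_defs)
      ultimately have "H_split_mono \<Lambda> ?A X t" unfolding H_split_mono_def by (rule bexI[rotated])
      then show False using nsplit by simp
    qed
    \<comment> \<open>The module \<open>K\<close> lives over the small type, so it is an admissible
      test object for \<open>u\<close>.\<close>
    then obtain s' where s': "s' \<in> mod_hom \<Lambda> B K" "\<And>x. x \<in> carrier P \<Longrightarrow> s' (u x) = \<pi> (t2 x)"
      using las K mod_hom_comp[OF t2 \<pi>(1)] unfolding left_almost_split_def by meson
    note s'd = mod_hom_comp[OF d(1) s'(1)]
    have s'd_inr: "(\<lambda>y. s' (d (\<zero>\<^bsub>P\<^esub>, y))) \<in> mod_hom \<Lambda> Q0 K"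
      by (rule mod_hom_comp[OF mod_hom_inr[OF lm(1)] s'd])
    \<comment> \<open>Only the restriction of \<open>s' d\<close> to \<open>Q0\<close> has to be
      lifted along \<open>\<pi>\<close>; on \<open>P\<close> it equals \<open>\<pi> t2\<close>, so
      \<open>t2\<close> is already a lift there.\<close>
    obtain w where w: "w \<in> mod_hom \<Lambda> Q0 X2"
      "\<And>y. y \<in> carrier Q0 \<Longrightarrow> \<pi> (w y) = s' (d (\<zero>\<^bsub>P\<^esub>, y))"
      using projective_lift[OF proj(1) fgX(2) K.left_module_axioms \<pi>(1) s'd_inr] \<pi>(2)
        mod_hom_closed[OF s'd_inr] by auto
    define s2 where "s2 z = t2 (fst z) \<oplus>\<^bsub>X2\<^esub> w (snd z)" for z
    have s2: "s2 \<in> mod_hom \<Lambda> ?S X2"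
      unfolding s2_def by (rule mod_hom_copair[OF X2.left_module_axioms t2 w(1)])
    have \<pi>s2: "\<pi> (s2 z) = s' (d z)" if z: "z \<in> carrier ?S" for z
    proof -
      obtain x y where xy: "z = (x, y)" "x \<in> carrier P" "y \<in> carrier Q0" using z by auto
      have "\<pi> (s2 z) = \<pi> (t2 x) \<oplus>\<^bsub>K\<^esub> \<pi> (w y)"
        using xy mod_hom_closed[OF t2] mod_hom_closed[OF w(1)]
        by (simp add: s2_def mod_hom_add[OF \<pi>(1)])
      also have "\<dots> = s' (d (x, \<zero>\<^bsub>Q0\<^esub>)) \<oplus>\<^bsub>K\<^esub> s' (d (\<zero>\<^bsub>P\<^esub>, y))"
        using xy left_square w(2) s'(2) by simp
      also have "\<dots> = s' (d (x, y))"
        using mod_hom_direct_sum_split[OF lm(1,4) s'd xy(2,3)] by simp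
      finally show ?thesis using xy(1) by simp
    qed
    have s2hj: "(\<lambda>x. s2 (h (j x))) \<in> mod_hom \<Lambda> Q1 X2" by (rule mod_hom_comp[OF hj s2])
    \<comment> \<open>Here \<open>\<pi> s2 h j = s' d h j = 0\<close>, so \<open>s2 h j\<close>
      lands in the kernel of \<open>\<pi>\<close>, the image of \<open>a\<close>, and projectivity
      of \<open>Q1\<close> gives the source component.\<close>
    have "s2 (h (j x)) \<in> a ` carrier X1" if x: "x \<in> carrier Q1" for x
      using \<pi>s2[OF mod_hom_closed[OF hj x]] dh[OF jcl(1)[OF x]] mod_hom_closed[OF s2hj x]
        mod_hom_zero[OF lm(2) K.left_module_axioms s'(1)]
      by (simp add: mod_kernel_def flip: ker)
    then obtain s1 where s1: "s1 \<in> mod_hom \<Lambda> Q1 X1" "\<And>x. x \<in> carrier Q1 \<Longrightarrow> a (s1 x) = s2 (h (j x))"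
      using projective_lift[OF proj(2) fgX(1) X2.left_module_axioms a s2hj] by blast
    have s2_inl: "s2 (x, \<zero>\<^bsub>Q0\<^esub>) = t2 x" if "x \<in> carrier P" for x
      using that mod_hom_zero[OF lm(4) X2.left_module_axioms w(1)] mod_hom_closed[OF t2 that]
      by (simp add: s2_def)
    have "(s1, s2) \<in> H_hom \<Lambda> ?E X"
      using s1 s2 by (auto simp: H_hom_def simp flip: X_defs)
    moreover have "H_comp_eq ?A (s1, s2) ?f t"
      using t1_0 s2_inl mod_hom_zero[OF lm(5) X1.left_module_axioms s1(1)]
      by (auto simp: H_comp_eq_def simp flip: X_defs)
    ultimately show ?thesis by (rule bexI[rotated])
  qed

  \<comment> \<open>The second morphism does not split\<close>
  have not_epi: "\<not> H_split_epi \<Lambda> ?E ?D ?g"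
  proof
    assume "H_split_epi \<Lambda> ?E ?D ?g"
    then obtain s1 s2 where s1: "\<And>x. x \<in> carrier Q1 \<Longrightarrow> s1 x = x" and s2: "s2 \<in> mod_hom \<Lambda> Q0 ?S"
      "\<And>y. y \<in> carrier Q0 \<Longrightarrow> snd (s2 y) = y"
      and comm: "\<And>x. x \<in> carrier Q1 \<Longrightarrow> s2 (j x) = h (j (s1 x))"
      by (auto simp: H_split_epi_def H_hom_def H_comp_eq_def H_id_def i_def)
    \<comment> \<open>The kernel of \<open>q\<close> is the image of \<open>j\<close>, and
      \<open>s2 j = h j\<close> because \<open>s1\<close> is the identity; \<open>d\<close> kills
      this. So \<open>d s2\<close> induces a map \<open>s'\<close> on \<open>C\<close>, and
      \<open>v s' q = v d s2 = q\<close> makes it a section of \<open>v\<close>.\<close>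
    have "d (s2 y) = \<zero>\<^bsub>B\<^esub>" if "y \<in> carrier Q0" "q y = \<zero>\<^bsub>C\<^esub>" for y
    proof -
      have "y \<in> j ` carrier Q1" using that j(2) by (simp add: \<Omega>)
      then show ?thesis using comm s1 dh jcl by auto
    qed
    then obtain s' where s': "s' \<in> mod_hom \<Lambda> C B" "\<And>y. y \<in> carrier Q0 \<Longrightarrow> s' (q y) = d (s2 y)"
      using mod_hom_factor[OF lm(4,3,2) q mod_hom_comp[OF s2(1) d(1)]] by blast
    have "v (s' (q y)) = q y" if "y \<in> carrier Q0" for y
      using that s'(2) s2(2) vd[OF mod_hom_closed[OF s2(1) that]] by simp
    then have "split_epi \<Lambda> B C v"
      using s'(1) q(2) by (auto simp: split_epi_def intro!: bexI[of _ s'] simp flip: q(2))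
    then show False using ras by (simp add: right_almost_split_def)
  qed

  \<comment> \<open>Lifting morphisms that end at \<open>Q1 -> Q0\<close>\<close>
  have right: "\<exists>s \<in> H_hom \<Lambda> X ?E. H_comp_eq X ?g s t"
    if X: "H_obj \<Lambda> X" and t: "t \<in> H_hom \<Lambda> X ?D" and nsplit: "\<not> H_split_epi \<Lambda> X ?D t"
    for X :: "('a, 'a small, 'a small) morph_obj" and t
  proof -
    define X1 X2 a t1 t2 where "X1 = src X" and "X2 = tgt X" and "a = arr X" and "t1 = fst t"
      and "t2 = snd t"
    note X_defs = X1_def X2_def a_def t1_def t2_def
    have fgX: "fg_module \<Lambda> X1" "fg_module \<Lambda> X2" and a: "a \<in> mod_hom \<Lambda> X1 X2"
      using X by (simp_all add: H_obj_def X_defs)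
    interpret X1: left_module \<Lambda> X1 by (rule fg_imp_left_module[OF fgX(1)])
    interpret X2: left_module \<Lambda> X2 by (rule fg_imp_left_module[OF fgX(2)])
    have t1: "t1 \<in> mod_hom \<Lambda> X1 Q1" and t2: "t2 \<in> mod_hom \<Lambda> X2 Q0"
      and comm: "\<And>x. x \<in> carrier X1 \<Longrightarrow> t2 (a x) = j (t1 x)"
      using t by (auto simp: H_hom_def X_defs i_def)
    obtain K :: "('a, 'a small) module" and \<pi> where K: "fg_module \<Lambda> K"
      and \<pi>: "\<pi> \<in> mod_hom \<Lambda> X2 K" "\<pi> ` carrier X2 = carrier K"
      and ker: "mod_kernel X2 K \<pi> = a ` carrier X1"
      using small_cokernel[OF X1.left_module_axioms fgX(2) a] by blast
    interpret K: left_module \<Lambda> K by (rule fg_imp_left_module[OF K])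
    have \<pi>a: "\<pi> (a x) = \<zero>\<^bsub>K\<^esub>" if "x \<in> carrier X1" for x
      using ker that by (auto simp: mod_kernel_def)
    \<comment> \<open>On the image of \<open>a\<close>, \<open>t2\<close> takes values in the image
      of \<open>j\<close>, which \<open>q\<close> kills; hence \<open>q t2\<close> induces a map on
      the cokernel.\<close>
    have "q (t2 x) = \<zero>\<^bsub>C\<^esub>" if "x \<in> carrier X2" "\<pi> x = \<zero>\<^bsub>K\<^esub>" for x
    proof -
      have "x \<in> a ` carrier X1" using that by (simp add: mod_kernel_def flip: ker)
      then show ?thesis using comm jcl(3) mod_hom_closed[OF t1] by auto
    qed
    then obtain t' where t': "t' \<in> mod_hom \<Lambda> K C" "\<And>x. x \<in> carrier X2 \<Longrightarrow> t' (\<pi> x) = q (t2 x)"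
      using mod_hom_factor[OF X2.left_module_axioms K.left_module_axioms lm(3) \<pi>
          mod_hom_comp[OF t2 q(1)]] by blast
    have "\<not> split_epi \<Lambda> K C t'"
    proof
      assume "split_epi \<Lambda> K C t'"
      then obtain \<sigma> where \<sigma>: "\<sigma> \<in> mod_hom \<Lambda> C K" "\<And>y. y \<in> carrier C \<Longrightarrow> t' (\<sigma> y) = y"
        by (auto simp: split_epi_def)
      note \<sigma>q = mod_hom_comp[OF q(1) \<sigma>(1)]
      obtain w where w: "w \<in> mod_hom \<Lambda> Q0 X2" "\<And>y. y \<in> carrier Q0 \<Longrightarrow> \<pi> (w y) = \<sigma> (q y)"
        using projective_lift[OF proj(1) fgX(2) K.left_module_axioms \<pi>(1) \<sigma>q] \<pi>(2)
          mod_hom_closed[OF \<sigma>q] by auto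
      \<comment> \<open>By \<open>q t2 w = t' \<pi> w = t' \<sigma> q = q\<close>, the endomorphism
        \<open>t2 w\<close> of the cover \<open>Q0\<close> lies over \<open>C\<close>. It need not
        be the identity, so \<open>w\<close> is corrected by a section \<open>m\<close> of
        \<open>t2 w\<close>.\<close>
      have "q (t2 (w y)) = q y" if "y \<in> carrier Q0" for y
        using that w(2) t'(2)[OF mod_hom_closed[OF w(1) that]] \<sigma>(2) mod_hom_closed[OF q(1)] by simp
      then obtain m where m: "m \<in> mod_hom \<Lambda> Q0 Q0"
        "\<And>y. y \<in> carrier Q0 \<Longrightarrow> t2 (w (m y)) = y \<and> q (m y) = q y"
        using projective_cover_section[OF Q0 mod_hom_comp[OF w(1) t2]] by auto
      have wm: "(\<lambda>y. w (m y)) \<in> mod_hom \<Lambda> Q0 X2" by (rule mod_hom_comp[OF m(1) w(1)])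
      have wmj: "(\<lambda>y. w (m (j y))) \<in> mod_hom \<Lambda> Q1 X2" by (rule mod_hom_comp[OF ij wm])
      \<comment> \<open>Compatibility of \<open>m\<close> with \<open>q\<close> gives
        \<open>\<pi> w m j = \<sigma> q m j = \<sigma> q j = 0\<close>.\<close>
      have "w (m (j y)) \<in> a ` carrier X1" if y: "y \<in> carrier Q1" for y
        using w(2)[OF mod_hom_closed[OF m(1) jcl(2)[OF y]]] m(2)[OF jcl(2)[OF y]] jcl(3)[OF y]
          mod_hom_closed[OF wmj y] mod_hom_zero[OF lm(3) K.left_module_axioms \<sigma>(1)]
        by (simp add: mod_kernel_def flip: ker)
      then obtain y where y: "y \<in> mod_hom \<Lambda> Q1 X1"
        "\<And>x. x \<in> carrier Q1 \<Longrightarrow> a (y x) = w (m (j x))"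
        using projective_lift[OF proj(2) fgX(1) X2.left_module_axioms a wmj] by blast
      \<comment> \<open>From \<open>j t1 y = t2 a y = t2 w m j = j\<close>, the endomorphism
        \<open>t1 y\<close> of the cover \<open>Q1\<close> lies over \<open>\<Omega>\<close>; the
        same correction applies, now by \<open>n\<close>.\<close>
      have "j (t1 (y x)) = j x" if "x \<in> carrier Q1" for x
        using comm[OF mod_hom_closed[OF y(1) that]] y(2)[OF that] m(2) jcl(2)[OF that] by simp
      then obtain n where n: "n \<in> mod_hom \<Lambda> Q1 Q1"
        "\<And>x. x \<in> carrier Q1 \<Longrightarrow> t1 (y (n x)) = x \<and> j (n x) = j x"
        using projective_cover_section[OF Q1 mod_hom_comp[OF y(1) t1]] by auto
      have yn: "(\<lambda>x. y (n x)) \<in> mod_hom \<Lambda> Q1 X1" by (rule mod_hom_comp[OF n(1) y(1)])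
      \<comment> \<open>The correction by \<open>n\<close> keeps the square commutative because
        \<open>j n = j\<close>: \<open>a y n = w m j n = w m j\<close>.\<close>
      have "(\<lambda>x. y (n x), \<lambda>x. w (m x)) \<in> H_hom \<Lambda> ?D X"
        using wm yn y(2) n(2) mod_hom_closed[OF n(1)]
        by (auto simp: H_hom_def i_def simp flip: X_defs)
      moreover have "H_comp_eq ?D t (\<lambda>x. y (n x), \<lambda>x. w (m x)) H_id"
        using m(2) n(2) by (simp add: H_comp_eq_def H_id_def flip: X_defs)
      ultimately have "H_split_epi \<Lambda> X ?D t" unfolding H_split_epi_def by (rule bexI[rotated])
      then show False using nsplit by simp
    qed
    then obtain w where w: "w \<in> mod_hom \<Lambda> K B" "\<And>x. x \<in> carrier K \<Longrightarrow> v (w x) = t' x"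
      using ras K t'(1) unfolding right_almost_split_def by meson
    have vw: "\<forall>x \<in> carrier X2. v (w (\<pi> x)) = q (t2 x)"
      using w(2) t'(2) mod_hom_closed[OF \<pi>(1)] by simp
    \<comment> \<open>Existence in the pull-back property, for the compatible pair
      \<open>w \<pi>\<close> and \<open>t2\<close>.\<close>
    obtain s2 where s2: "s2 \<in> mod_hom \<Lambda> X2 ?S"
      "\<forall>x \<in> carrier X2. d (s2 x) = w (\<pi> x) \<and> snd (s2 x) = t2 x"
      using pb[OF fgX(2) mod_hom_comp[OF \<pi>(1) w(1)] t2 vw, THEN conjunct1] by (rule bexE)
    note ht1 = mod_hom_comp[OF t1 hj] and s2a = mod_hom_comp[OF a s2(1)]
    \<comment> \<open>The zero map to \<open>B\<close> and \<open>j t1\<close> form the compatible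
      pair to which uniqueness in the pull-back property is applied: both \<open>s2 a\<close> and
      \<open>h j t1\<close> induce it, so they agree and the square commutes.\<close>
    have zeroB: "(\<lambda>x. \<zero>\<^bsub>B\<^esub>) \<in> mod_hom \<Lambda> X1 B"
      by (rule mod_hom_comp[OF mod_hom_to_zero_module mod_hom_from_zero_module[OF lm(2)]])
    have jt1: "(\<lambda>x. j (t1 x)) \<in> mod_hom \<Lambda> X1 Q0" by (rule mod_hom_comp[OF t1 ij])
    have sq: "\<forall>x \<in> carrier X1. v \<zero>\<^bsub>B\<^esub> = q (j (t1 x))"
      using mod_hom_zero[OF lm(2,3) v] jcl(3) mod_hom_closed[OF t1] by simp
    have "\<forall>x \<in> carrier X1. d (s2 (a x)) = \<zero>\<^bsub>B\<^esub> \<and> snd (s2 (a x)) = j (t1 x)"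
      using s2(2) mod_hom_closed[OF a] \<pi>a comm
        mod_hom_zero[OF K.left_module_axioms lm(2) w(1)] by simp
    moreover have "\<forall>x \<in> carrier X1. d (h (j (t1 x))) = \<zero>\<^bsub>B\<^esub> \<and> snd (h (j (t1 x))) = j (t1 x)"
      using dh snd_h jcl(1)[OF mod_hom_closed[OF t1]] by simp
    ultimately have "\<forall>x \<in> carrier X1. s2 (a x) = h (j (t1 x))"
      using pb[OF fgX(1) zeroB jt1 sq, THEN conjunct2, THEN bspec, OF s2a, THEN bspec, OF ht1]
      by blast
    then have "(t1, s2) \<in> H_hom \<Lambda> X ?E"
      using t1 s2(1) by (auto simp: H_hom_def simp flip: X_defs)
    moreover have "H_comp_eq X ?g (t1, s2) t"
      using s2(2) by (simp add: H_comp_eq_def flip: X_defs)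
    ultimately show ?thesis by (rule bexI[rotated])
  qed

  \<comment> \<open>Both lifting properties hold for all objects of \<open>\<H>(\<Lambda>)\<close>,
    hence for those with projective components. Splitting does not refer to the class of test
    objects, so the same non-splitting serves both claims.\<close>
  show ?thesis
    using objs exact f g not_mono not_epi left right
    by (auto simp: almost_split_in_H_def almost_split_in_P_def H_left_almost_split_def
        H_right_almost_split_def P_obj_def)
qed

end
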